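(* For a semigroup $S$, the following are equivalent: (1) The proper IP sets in $S$ are partition regular: for every proper IP set $A\subseteq S$ and every partition of $A$ into finitely many pieces, some piece is a proper IP set. (2) Every bijective (injective) sequence in $S$ has a proper sumsequence. (3) $S$ has no subsemigroup isomorphic to (or of) any of the following types: (a) an infinite semigroup $S'$ such that $S'+S'$ is finite; (b) the fan semilattice, i.e. $\mathbb N$ with the operation $m\wedge n:=1$ for distinct $m,n$ and $n\wedge n:=n$; (c) the semigroup $(\mathbb N\times\mathbb N)\cup\{0\}$ with $0+x=x+0:=0$ for all $x$, and $(m_1,n_1)+(m_2,n_2):=(m_1,n_1+n_2)$ if $m_1=m_2$, and $:=0$ otherwise. (4) For every bijective sequence $a_1,a_2,\dotsc$ in $S$ and every finite coloring of $S$, there is a bijective sumsequence $b_1,b_2,\dotsc$ of it such that $\mathrm{FS}(b_1,b_2,\dotsc)$ is monochromatic. (5) For every bijective sequence $a_1,a_2,\dotsc$ in $S$ and every finite coloring of $S$, there is a proper sumsequence $b_1,b_2,\dotsc$ of it such that $\mathrm{FS}(b_1,b_2,\dotsc)$ is monochromatic.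
   Context: Semigroups are written additively and are not assumed commutative. For a sequence $a_1,a_2,\dotsc$, $\mathrm{FS}(a_1,a_2,\dotsc):=\{a_{i_1}+\dotsb+a_{i_m}: m\ge1,\ i_1<\dotsb<i_m\}$. A proper IP set is a set containing $\mathrm{FS}(b_1,b_2,\dotsc)$ for some bijective (injective) sequence $b_1,b_2,\dotsc$. For a finite nonempty index set $F=\{i_1<\dotsb<i_m\}$, $a_F:=a_{i_1}+\dotsb+a_{i_m}$; $F_1<F_2$ means every element of $F_1$ is smaller than every element of $F_2$. A sumsequence of $a_1,a_2,\dotsc$ is a sequence $a_{F_1},a_{F_2},\dotsc$ for nonempty finite index sets $F_1<F_2<\dotsb$. A sequence is proper if $a_{F_1}\ne a_{F_2}$ for all nonempty finite $F_1<F_2$. A finite coloring is a map into a finite set; a set is monochromatic if the coloring is constant on it. *)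

theory Defs
  imports Main
begin

text \<open>Semigroups are written additively (type class semigroup_add, not assumed
commutative); the semigroup S is the whole carrier type.\<close>

fun sum1 :: "('a::semigroup_add) list \<Rightarrow> 'a" where
  "sum1 [] = undefined"
| "sum1 [x] = x"
| "sum1 (x # y # xs) = x + sum1 (y # xs)"

definition idxsum :: "(nat \<Rightarrow> 'a::semigroup_add) \<Rightarrow> nat set \<Rightarrow> 'a" where
  "idxsum a F = sum1 (map a (sorted_list_of_set F))"

definition FS :: "(nat \<Rightarrow> 'a::semigroup_add) \<Rightarrow> 'a set" where
  "FS a = {idxsum a F | F. finite F \<and> F \<noteq> {}}"

definition set_less :: "nat set \<Rightarrow> nat set \<Rightarrow> bool" where
  "set_less F G \<longleftrightarrow> (\<forall>x\<in>F. \<forall>y\<in>G. x < y)"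

definition proper_IP :: "'a::semigroup_add set \<Rightarrow> bool" where
  "proper_IP A \<longleftrightarrow> (\<exists>b. inj b \<and> FS b \<subseteq> A)"

definition sumsequence :: "(nat \<Rightarrow> 'a::semigroup_add) \<Rightarrow> (nat \<Rightarrow> 'a) \<Rightarrow> bool" where
  "sumsequence b a \<longleftrightarrow> (\<exists>Fs :: nat \<Rightarrow> nat set.
      (\<forall>i. finite (Fs i) \<and> Fs i \<noteq> {}) \<and>
      (\<forall>i j. i < j \<longrightarrow> set_less (Fs i) (Fs j)) \<and>
      (\<forall>i. b i = idxsum a (Fs i)))"

definition proper_seq :: "(nat \<Rightarrow> 'a::semigroup_add) \<Rightarrow> bool" where
  "proper_seq a \<longleftrightarrow> (\<forall>F1 F2. finite F1 \<and> F1 \<noteq> {} \<and> finite F2 \<and> F2 \<noteq> {} \<and>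
      set_less F1 F2 \<longrightarrow> idxsum a F1 \<noteq> idxsum a F2)"

definition finite_coloring :: "('a \<Rightarrow> nat) \<Rightarrow> bool" where
  "finite_coloring c \<longleftrightarrow> finite (range c)"

definition cond1 :: "'a::semigroup_add itself \<Rightarrow> bool" where
  "cond1 _ \<longleftrightarrow> (\<forall>(A::'a set) (c::'a \<Rightarrow> nat). proper_IP A \<and> finite (c ` A) \<longrightarrow>
      (\<exists>k. proper_IP {x\<in>A. c x = k}))"

definition cond2 :: "'a::semigroup_add itself \<Rightarrow> bool" where
  "cond2 _ \<longleftrightarrow> (\<forall>a :: nat \<Rightarrow> 'a. inj a \<longrightarrow> (\<exists>b. sumsequence b a \<and> proper_seq b))"

definition has_type_a :: "'a::semigroup_add itself \<Rightarrow> bool" where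
  "has_type_a _ \<longleftrightarrow> (\<exists>T :: 'a set. (\<forall>x\<in>T. \<forall>y\<in>T. x + y \<in> T) \<and> infinite T \<and>
      finite {x + y | x y. x \<in> T \<and> y \<in> T})"

text \<open>(b) subsemigroup isomorphic to the fan semilattice on positive naturals:
  f is an injective homomorphism from the fan semilattice (onto its image).\<close>
definition has_type_b :: "'a::semigroup_add itself \<Rightarrow> bool" where
  "has_type_b _ \<longleftrightarrow> (\<exists>f :: nat \<Rightarrow> 'a. inj_on f {1..} \<and>
      (\<forall>m\<ge>1. \<forall>n\<ge>1. m \<noteq> n \<longrightarrow> f m + f n = f 1) \<and>
      (\<forall>n\<ge>1. f n + f n = f n))"

text \<open>(c) subsemigroup isomorphic to (N x N) with zero, N = positive naturals:
  z is the image of 0, g the image of pairs.\<close>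
definition has_type_c :: "'a::semigroup_add itself \<Rightarrow> bool" where
  "has_type_c _ \<longleftrightarrow> (\<exists>(z::'a) (g :: nat \<times> nat \<Rightarrow> 'a).
      inj_on g {p. fst p \<ge> 1 \<and> snd p \<ge> 1} \<and>
      z \<notin> g ` {p. fst p \<ge> 1 \<and> snd p \<ge> 1} \<and>
      z + z = z \<and>
      (\<forall>m\<ge>1. \<forall>n\<ge>1. z + g (m, n) = z \<and> g (m, n) + z = z) \<and>
      (\<forall>m\<ge>1. \<forall>n1\<ge>1. \<forall>n2\<ge>1. g (m, n1) + g (m, n2) = g (m, n1 + n2)) \<and>
      (\<forall>m1\<ge>1. \<forall>m2\<ge>1. \<forall>n1\<ge>1. \<forall>n2\<ge>1. m1 \<noteq> m2 \<longrightarrow> g (m1, n1) + g (m2, n2) = z))"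

definition cond3 :: "'a::semigroup_add itself \<Rightarrow> bool" where
  "cond3 t \<longleftrightarrow> \<not> has_type_a t \<and> \<not> has_type_b t \<and> \<not> has_type_c t"

definition cond4 :: "'a::semigroup_add itself \<Rightarrow> bool" where
  "cond4 _ \<longleftrightarrow> (\<forall>(a :: nat \<Rightarrow> 'a) (c :: 'a \<Rightarrow> nat). inj a \<and> finite_coloring c \<longrightarrow>
      (\<exists>b k. sumsequence b a \<and> inj b \<and> (\<forall>x\<in>FS b. c x = k)))"

definition cond5 :: "'a::semigroup_add itself \<Rightarrow> bool" where
  "cond5 _ \<longleftrightarrow> (\<forall>(a :: nat \<Rightarrow> 'a) (c :: 'a \<Rightarrow> nat). inj a \<and> finite_coloring c \<longrightarrow>
      (\<exists>b k. sumsequence b a \<and> proper_seq b \<and> (\<forall>x\<in>FS b. c x = k)))"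

end

theory Submission
  imports Defs "HOL-Library.Infinite_Set"
begin

text \<open>
The space of ultrafilters on S is a compact right topological semigroup. For an injective
sequence \<open>a\<close>, the ultrafilters containing all sets \<open>FS(a n, a (n+1), \<dots>)\<close> form a closed
subsemigroup T with nonprincipal elements. If T contains a nonprincipal idempotent, then the
Galvin--Glazer argument yields a proper sumsequence with monochromatic sums, whence (5).

Otherwise let M be a minimal closed subsemigroup of T among those having nonprincipal elements.
Such an M contains a nonprincipal \<open>p\<close> with \<open>p + p = s\<close> principal, and some multiple of \<open>s\<close> is an
idempotent. Hence there is an injective sequence with \<open>b i + b j = s\<close> for all \<open>i < j\<close>. The sums of
\<open>b\<close> containing an ascent take finitely many values, and either the sums \<open>b j + b i\<close> with
\<open>i < j\<close> already produce type (a), or all sums other than multiples of a single \<open>b i\<close> may be assumed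
to lie in a finite ideal. Then the multiples of the \<open>b i\<close> produce type (a), (b) or (c).

Conversely, each of the types provides an injective sequence whose sums of at least two terms
lie in a finite set, which contradicts (1) and (2).
\<close>

section \<open>Ultrafilters on a semigroup\<close>

text \<open>Closure under supersets is not a clause; \<open>members_mono\<close> derives it from the
  alternative between a set and its complement.\<close>

definition is_ultra :: "'a set set \<Rightarrow> bool" where
  "is_ultra U \<longleftrightarrow> {} \<notin> U \<and> (\<forall>A\<in>U. \<forall>B\<in>U. A \<inter> B \<in> U) \<and> (\<forall>A. A \<in> U \<or> - A \<in> U)"

typedef 'a uf = "{U :: 'a set set. is_ultra U}" morphisms members Abs_uf
proof
  show "{A. undefined \<in> A} \<in> {U :: 'a set set. is_ultra U}"
    by (auto simp: is_ultra_def)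
qed

lemma members_empty [simp]: "{} \<notin> members p"
  using members[of p] by (simp add: is_ultra_def)

lemma members_compl: "- A \<in> members p \<longleftrightarrow> A \<notin> members p"
proof -
  have "A \<inter> - A = {}" by simp
  then show ?thesis
    using members[of p] unfolding is_ultra_def mem_Collect_eq by metis
qed

lemma members_mono: "A \<in> members p \<Longrightarrow> A \<subseteq> B \<Longrightarrow> B \<in> members p"
proof (rule ccontr)
  assume "A \<in> members p" "A \<subseteq> B" "B \<notin> members p"
  then have "A \<in> members p" "- B \<in> members p" "A \<inter> - B = {}"
    by (auto simp: members_compl)
  then show False
    using members[of p] unfolding is_ultra_def mem_Collect_eq by metis
qed

lemma members_Int: "A \<inter> B \<in> members p \<longleftrightarrow> A \<in> members p \<and> B \<in> members p"
  using members[of p] members_mono[of "A \<inter> B" p] unfolding is_ultra_def by blast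

lemma members_UNIV [simp]: "UNIV \<in> members p"
  using members_compl[of UNIV p] by simp

lemma members_nonempty: "A \<in> members p \<Longrightarrow> A \<noteq> {}"
  by auto

lemma members_Un: "A \<union> B \<in> members p \<longleftrightarrow> A \<in> members p \<or> B \<in> members p"
  using members_Int[of "-A" "-B" p] members_compl[of A p] members_compl[of B p]
    members_compl[of "A \<union> B" p] by auto

lemma members_finite_UN:
  "finite I \<Longrightarrow> (\<Union>i\<in>I. A i) \<in> members p \<Longrightarrow> \<exists>i\<in>I. A i \<in> members p"
  by (induction I rule: finite_induct) (auto simp: members_Un)

lemma members_finite_INT:
  "finite I \<Longrightarrow> (\<And>i. i \<in> I \<Longrightarrow> A i \<in> members p) \<Longrightarrow> (\<Inter>i\<in>I. A i) \<in> members p"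
  by (induction I rule: finite_induct) (auto simp: members_Int)

text \<open>One inclusion suffices because ultrafilters are maximal: a set of \<open>q\<close>
  outside \<open>p\<close> would have its complement in \<open>p\<close>, hence in
  \<open>q\<close>.\<close>

lemma uf_eqI: "(\<And>A. A \<in> members p \<Longrightarrow> A \<in> members q) \<Longrightarrow> p = q"
  by (metis members_compl members_inject subsetI subset_antisym)

text \<open>The ultrafilter lemma, by Zorn. A maximal family contains every set that meets all its
  members, and this forces \<open>A\<close> or \<open>- A\<close> into it.\<close>

lemma uf_extend:
  fixes \<F> :: "'a set set"
  assumes "\<F> \<noteq> {}" "{} \<notin> \<F>" "\<And>A B. A \<in> \<F> \<Longrightarrow> B \<in> \<F> \<Longrightarrow> A \<inter> B \<in> \<F>"
  shows "\<exists>p. \<F> \<subseteq> members p"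
proof -
  define \<A> where "\<A> = {\<G>. \<F> \<subseteq> \<G> \<and> {} \<notin> \<G> \<and> (\<forall>A\<in>\<G>. \<forall>B\<in>\<G>. A \<inter> B \<in> \<G>)}"
  have "\<exists>M\<in>\<A>. \<forall>X\<in>\<A>. M \<subseteq> X \<longrightarrow> X = M"
  proof (rule subset_Zorn_nonempty)
    show "\<A> \<noteq> {}" using assms by (auto simp: \<A>_def)
  next
    fix \<C> assume ne: "\<C> \<noteq> {}" and ch: "subset.chain \<A> \<C>"
    have "A \<inter> B \<in> \<Union>\<C>" if AB: "A \<in> X" "X \<in> \<C>" "B \<in> Y" "Y \<in> \<C>" for A B X Y
    proof -
      obtain Z where "Z \<in> \<C>" "A \<in> Z" "B \<in> Z"
        using ch AB unfolding subset_chain_def by blast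
      moreover have "Z \<in> \<A>" using ch \<open>Z \<in> \<C>\<close> unfolding subset_chain_def by blast
      ultimately show ?thesis unfolding \<A>_def by blast
    qed
    moreover have "\<C> \<subseteq> \<A>" using ch unfolding subset_chain_def by blast
    then have "\<F> \<subseteq> \<Union>\<C>" "{} \<notin> \<Union>\<C>" using ne unfolding \<A>_def by blast+
    ultimately show "\<Union>\<C> \<in> \<A>" unfolding \<A>_def by blast
  qed
  then obtain M where M: "M \<in> \<A>" and max: "\<And>X. X \<in> \<A> \<Longrightarrow> M \<subseteq> X \<Longrightarrow> X = M" by blast
  have F: "\<F> \<subseteq> M" "{} \<notin> M" and int: "\<And>A B. A \<in> M \<Longrightarrow> B \<in> M \<Longrightarrow> A \<inter> B \<in> M"
    using M by (auto simp: \<A>_def)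
  have in_M: "A \<in> M" if meets: "\<And>C. C \<in> M \<Longrightarrow> A \<inter> C \<noteq> {}" for A
  proof -
    \<comment> \<open>The upward closure of what \<open>A\<close> and \<open>M\<close> generate;
      maximality makes it equal to \<open>M\<close>.\<close>
    define X where "X = {Z. \<exists>C\<in>M. A \<inter> C \<subseteq> Z}"
    have "M \<subseteq> X" "A \<in> X" using F assms(1) by (auto simp: X_def)
    moreover have "Y \<inter> Z \<in> X" if YZ: "Y \<in> X" "Z \<in> X" for Y Z
    proof -
      obtain C D where CD: "C \<in> M" "D \<in> M" "A \<inter> C \<subseteq> Y" "A \<inter> D \<subseteq> Z"
        using YZ unfolding X_def by blast
      then have "A \<inter> (C \<inter> D) \<subseteq> Y \<inter> Z" by blast
      then show ?thesis using int[OF CD(1,2)] unfolding X_def by (intro CollectI bexI)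
    qed
    moreover have "{} \<notin> X" using meets by (simp add: X_def)
    moreover have "\<F> \<subseteq> X" using F(1) \<open>M \<subseteq> X\<close> by (rule subset_trans)
    ultimately have "X \<in> \<A>" unfolding \<A>_def by simp
    then have "X = M" using max \<open>M \<subseteq> X\<close> by simp
    then show ?thesis using \<open>A \<in> X\<close> by simp
  qed
  have "A \<in> M \<or> - A \<in> M" for A
  proof (rule ccontr)
    assume "\<not> ?thesis"
    then obtain C D where CD: "C \<in> M" "D \<in> M" "A \<inter> C = {}" "- A \<inter> D = {}" using in_M by metis
    then have "C \<inter> D = {}" by blast
    with CD int F show False by metis
  qed
  then have "is_ultra M" using F int by (auto simp: is_ultra_def)
  then show ?thesis using F Abs_uf_inverse[of M] by auto
qed

section \<open>Principal and nonprincipal ultrafilters\<close>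

definition princ :: "'a \<Rightarrow> 'a uf" where
  "princ x = Abs_uf {A. x \<in> A}"

lemma members_princ [simp]: "members (princ x) = {A. x \<in> A}"
  unfolding princ_def by (rule Abs_uf_inverse) (auto simp: is_ultra_def)

lemma princ_iff: "{x} \<in> members p \<longleftrightarrow> p = princ x"
proof
  assume *: "{x} \<in> members p"
  have "princ x = p"
    by (rule uf_eqI) (use * in \<open>auto intro: members_mono\<close>)
  then show "p = princ x" ..
qed simp

lemma princ_inject [simp]: "princ x = princ y \<longleftrightarrow> x = y"
  by (metis princ_iff members_princ mem_Collect_eq singletonD)

lemma nonprinc_cofinite:
  assumes "p \<notin> range princ" "finite E" shows "- E \<in> members p"
proof -
  have "(\<Union>x\<in>E. {x}) \<notin> members p"
    using members_finite_UN[OF assms(2), of "\<lambda>x. {x}" p] assms(1) by (auto simp: princ_iff)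
  then show ?thesis by (simp add: members_compl)
qed

lemma nonprinc_diff:
  assumes "p \<notin> range princ" "finite E" "A \<in> members p" shows "A - E \<in> members p"
  using nonprinc_cofinite[OF assms(1,2)] assms(3) by (simp add: Diff_eq members_Int)

text \<open>Extends the filter base of cofinite subsets of \<open>B\<close>; removing one point
  excludes each principal ultrafilter.\<close>

lemma nonprinc_exists:
  assumes "infinite B" shows "\<exists>p. p \<notin> range princ \<and> B \<in> members p"
proof -
  let ?F = "{B - E | E. finite E}"
  have "\<exists>p. ?F \<subseteq> members p"
  proof (rule uf_extend)
    show "{} \<notin> ?F"
      using assms by (auto simp: finite_subset)
    fix X Y assume "X \<in> ?F" "Y \<in> ?F"
    then obtain E F where "X = B - E" "Y = B - F" "finite E" "finite F" by blast
    then have "X \<inter> Y = B - (E \<union> F)" "finite (E \<union> F)" by auto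
    then show "X \<inter> Y \<in> ?F" by blast
  qed auto
  then obtain p where p: "?F \<subseteq> members p" by blast
  have "B - {} \<in> members p" using p by fast
  moreover have "p \<notin> range princ"
  proof
    assume "p \<in> range princ"
    then obtain x where "p = princ x" by blast
    moreover have "B - {x} \<in> ?F" by blast
    then have "B - {x} \<in> members p" using p by (rule rev_subsetD)
    ultimately show False by simp
  qed
  ultimately show ?thesis by auto
qed

section \<open>The semigroup operation on ultrafilters\<close>

instantiation uf :: (semigroup_add) semigroup_add
begin

text \<open>The usual extension of addition to the Stone-Cech compactification of the discrete
  semigroup. Taking \<open>p\<close> outermost makes each right translation continuous.\<close>

definition plus_uf :: "'a uf \<Rightarrow> 'a uf \<Rightarrow> 'a uf" where
  "p + q = Abs_uf {A. {x. {y. x + y \<in> A} \<in> members q} \<in> members p}"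

lemma members_plus:
  "members (p + q) = {A. {x. {y. x + y \<in> A} \<in> members q} \<in> members p}"
  unfolding plus_uf_def
proof (rule Abs_uf_inverse)
  have "{y. x + y \<in> A \<inter> B} = {y. x + y \<in> A} \<inter> {y. x + y \<in> B}"
    "{y. x + y \<in> - A} = - {y. x + y \<in> A}" for x :: 'a and A B by auto
  moreover have "{x. P x \<and> Q x} = {x. P x} \<inter> {x. Q x}" "{x. \<not> P x} = - {x. P x}" 
    for P Q :: "'a \<Rightarrow> bool" by auto
  ultimately show "{A. {x. {y. x + y \<in> A} \<in> members q} \<in> members p} \<in> {U. is_ultra U}"
    by (simp add: is_ultra_def members_Int members_compl)
qed

instance
proof
  fix p q r :: "'a uf"
  show "p + q + r = p + (q + r)"
    by (simp add: members_inject[symmetric] members_plus add.assoc)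
qed

end

lemma members_plusI:
  assumes "A \<in> members p" "\<And>x. x \<in> A \<Longrightarrow> {y. x + y \<in> C} \<in> members q"
  shows "C \<in> members (p + q)"
  unfolding members_plus using assms by (auto intro: members_mono)

lemma princ_plus_princ: "princ x + princ y = princ (x + y)"
  by (simp add: members_inject[symmetric] members_plus)

text \<open>Expresses that principal ultrafilters are isolated: \<open>{x}\<close> itself lies in
  \<open>p + q\<close>.\<close>

lemma plus_eq_princD:
  assumes "p + q = princ x"
  shows "{y. princ y + q = princ x} \<in> members p"
proof -
  have "{x} \<in> members (p + q)" using assms by simp
  then show ?thesis by (simp add: princ_iff[symmetric] members_plus)
qed

section \<open>Closed subsemigroups\<close>

text \<open>The sets \<open>{q. A \<in> members q}\<close> are the basic open sets of the Stone
  space, so \<open>X\<close> is closed when it contains all its adherent points.\<close>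

definition uf_closed :: "'a uf set \<Rightarrow> bool" where
  "uf_closed X \<longleftrightarrow> (\<forall>p. (\<forall>A\<in>members p. \<exists>q\<in>X. A \<in> members q) \<longrightarrow> p \<in> X)"

lemma uf_closedI:
  "(\<And>p. (\<And>A. A \<in> members p \<Longrightarrow> \<exists>q\<in>X. A \<in> members q) \<Longrightarrow> p \<in> X) \<Longrightarrow> uf_closed X"
  by (simp add: uf_closed_def)

lemma uf_closedD:
  "uf_closed X \<Longrightarrow> (\<And>A. A \<in> members p \<Longrightarrow> \<exists>q\<in>X. A \<in> members q) \<Longrightarrow> p \<in> X"
  by (simp add: uf_closed_def)

lemma uf_closed_UNIV: "uf_closed UNIV"
  by (simp add: uf_closed_def)

lemma uf_closed_INT: "(\<And>X. X \<in> \<C> \<Longrightarrow> uf_closed X) \<Longrightarrow> uf_closed (\<Inter>\<C>)"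
  by (rule uf_closedI, rule InterI, rule uf_closedD) blast+

lemma uf_closed_Int: "uf_closed X \<Longrightarrow> uf_closed Y \<Longrightarrow> uf_closed (X \<inter> Y)"
  using uf_closed_INT[of "{X, Y}"] by auto

lemma uf_closed_members: "uf_closed {p. A \<in> members p}"
proof (rule uf_closedI)
  fix p assume "\<And>B. B \<in> members p \<Longrightarrow> \<exists>q\<in>{p. A \<in> members p}. B \<in> members q"
  from this[of "- A"] show "p \<in> {p. A \<in> members p}"
    using members_compl by blast
qed

lemma uf_closed_nonprinc: "uf_closed (- range princ)"
proof (rule uf_closedI, rule ComplI)
  fix p :: "'a uf"
  assume *: "\<And>A. A \<in> members p \<Longrightarrow> \<exists>q\<in>- range princ. A \<in> members q" "p \<in> range princ"
  then obtain x where "p = princ x" by blast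
  then obtain q where "q \<in> - range princ" "{x} \<in> members q" using *(1)[of "{x}"] by auto
  then show False by (auto simp: princ_iff)
qed

text \<open>Compactness. The given family is joined by all sets common to the elements of
  \<open>X\<close>; an ultrafilter containing the latter is adherent to \<open>X\<close>.\<close>

lemma uf_closed_limit:
  assumes "uf_closed X" "\<F> \<noteq> {}" "\<And>A B. A \<in> \<F> \<Longrightarrow> B \<in> \<F> \<Longrightarrow> A \<inter> B \<in> \<F>"
    and meets: "\<And>A. A \<in> \<F> \<Longrightarrow> \<exists>p\<in>X. A \<in> members p"
  shows "\<exists>p\<in>X. \<F> \<subseteq> members p"
proof -
  let ?G = "{A \<inter> B | A B. A \<in> \<F> \<and> (\<forall>p\<in>X. B \<in> members p)}"
  have "\<exists>p. ?G \<subseteq> members p"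
  proof (rule uf_extend)
    show "?G \<noteq> {}" using assms(2) members_UNIV by blast
    show "{} \<notin> ?G"
    proof
      assume "{} \<in> ?G"
      then obtain A B where AB: "A \<inter> B = {}" "A \<in> \<F>" "\<forall>p\<in>X. B \<in> members p" by blast
      then obtain p where "A \<in> members p" "B \<in> members p" using meets by blast
      then have "A \<inter> B \<in> members p" by (simp add: members_Int)
      then show False using AB by simp
    qed
    fix C D assume "C \<in> ?G" "D \<in> ?G"
    then obtain A B A' B' where *: "C = A \<inter> B" "D = A' \<inter> B'" "A \<in> \<F>" "A' \<in> \<F>"
      "\<forall>p\<in>X. B \<in> members p" "\<forall>p\<in>X. B' \<in> members p" by blast
    then have "C \<inter> D = (A \<inter> A') \<inter> (B \<inter> B')" "A \<inter> A' \<in> \<F>" "\<forall>p\<in>X. B \<inter> B' \<in> members p"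
      using assms(3) by (auto simp: members_Int)
    then show "C \<inter> D \<in> ?G" by blast
  qed
  then obtain p where p: "?G \<subseteq> members p" by blast
  have p': "A \<in> members p \<and> B \<in> members p" if "A \<in> \<F>" "\<forall>p\<in>X. B \<in> members p" for A B
  proof -
    have "A \<inter> B \<in> ?G" using that by blast
    then have "A \<inter> B \<in> members p" using p by (rule rev_subsetD)
    then show ?thesis by (simp add: members_Int)
  qed
  have "p \<in> X"
  proof (rule uf_closedD[OF assms(1)], rule ccontr)
    fix A assume A: "A \<in> members p" "\<not> (\<exists>q\<in>X. A \<in> members q)"
    then have "\<forall>q\<in>X. - A \<in> members q" by (simp add: members_compl)
    then have "- A \<in> members p" using p' assms(2) by blast
    then show False using A(1) by (simp add: members_compl)
  qed
  moreover have "\<F> \<subseteq> members p" using p'[of _ UNIV] by auto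
  ultimately show ?thesis by blast
qed

text \<open>Compactness for chains: an ultrafilter containing every set common to all elements of
  some member of \<open>\<C>\<close> is adherent to each member of \<open>\<C>\<close>.\<close>

lemma uf_closed_chain:
  assumes "\<C> \<noteq> {}" and chain: "\<And>X Y. X \<in> \<C> \<Longrightarrow> Y \<in> \<C> \<Longrightarrow> X \<subseteq> Y \<or> Y \<subseteq> X"
    and closed: "\<And>X. X \<in> \<C> \<Longrightarrow> uf_closed X" and ne: "\<And>X. X \<in> \<C> \<Longrightarrow> X \<noteq> {}"
  shows "\<Inter>\<C> \<noteq> {}"
proof -
  let ?F = "{A. \<exists>X\<in>\<C>. \<forall>p\<in>X. A \<in> members p}"
  have "\<exists>p\<in>UNIV. ?F \<subseteq> members p"
  proof (rule uf_closed_limit[OF uf_closed_UNIV])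
    show "?F \<noteq> {}" using assms(1) members_UNIV by blast
    show "\<exists>p\<in>UNIV. A \<in> members p" if "A \<in> ?F" for A using that ne by blast
    fix A B assume "A \<in> ?F" "B \<in> ?F"
    then obtain X Y where XY: "X \<in> \<C>" "Y \<in> \<C>" "\<forall>p\<in>X. A \<in> members p" "\<forall>p\<in>Y. B \<in> members p"
      by blast
    then have "\<forall>p\<in>X \<inter> Y. A \<inter> B \<in> members p" by (simp add: members_Int)
    moreover have "X \<inter> Y \<in> \<C>" using chain[OF XY(1,2)] XY(1,2) by (auto simp: Int_absorb1 Int_absorb2)
    ultimately show "A \<inter> B \<in> ?F" by blast
  qed
  then obtain p where p: "?F \<subseteq> members p" by blast
  have "p \<in> X" if "X \<in> \<C>" for X
  proof (rule uf_closedD[OF closed[OF that]], rule ccontr)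
    fix A assume A: "A \<in> members p" "\<not> (\<exists>q\<in>X. A \<in> members q)"
    then have "\<forall>q\<in>X. - A \<in> members q" by (simp add: members_compl)
    then have "- A \<in> ?F" using that by blast
    then have "- A \<in> members p" using p by (rule rev_subsetD)
    then show False using A(1) by (simp add: members_compl)
  qed
  then show ?thesis by blast
qed

text \<open>A continuous image of a compact set is closed: the preimages \<open>?S A\<close> of the
  sets of \<open>p\<close> form a filter base, and its limit \<open>r\<close> in \<open>X\<close>
  satisfies \<open>r + q = p\<close>.\<close>

lemma uf_closed_plus_image:
  fixes q :: "'a::semigroup_add uf"
  assumes "uf_closed X" shows "uf_closed ((\<lambda>x. x + q) ` X)"
proof (rule uf_closedI)
  fix p assume p: "\<And>A. A \<in> members p \<Longrightarrow> \<exists>r\<in>(\<lambda>x. x + q) ` X. A \<in> members r"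
  let ?S = "\<lambda>A. {x. {y. x + y \<in> A} \<in> members q}"
  have "\<exists>r\<in>X. ?S ` members p \<subseteq> members r"
  proof (rule uf_closed_limit[OF assms])
    show "?S ` members p \<noteq> {}" using members_UNIV by blast
    fix C D assume "C \<in> ?S ` members p" "D \<in> ?S ` members p"
    then obtain A B where AB: "C = ?S A" "D = ?S B" "A \<in> members p" "B \<in> members p" by blast
    have "{y. x + y \<in> A \<inter> B} = {y. x + y \<in> A} \<inter> {y. x + y \<in> B}" for x by auto
    then have "C \<inter> D = ?S (A \<inter> B)" using AB by (auto simp: members_Int)
    moreover have "A \<inter> B \<in> members p" using AB by (simp add: members_Int)
    ultimately show "C \<inter> D \<in> ?S ` members p" by (rule image_eqI)
  next
    fix C assume "C \<in> ?S ` members p"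
    then obtain A where "C = ?S A" "A \<in> members p" by blast
    then show "\<exists>r\<in>X. C \<in> members r" using p[of A] by (auto simp: members_plus)
  qed
  then obtain r where r: "r \<in> X" "?S ` members p \<subseteq> members r" by blast
  have "p = r + q"
    by (rule uf_eqI) (use r in \<open>auto simp: members_plus\<close>)
  then show "p \<in> (\<lambda>x. x + q) ` X" using r by blast
qed

lemma uf_closed_plus_vimage:
  fixes q t :: "'a::semigroup_add uf"
  shows "uf_closed {x. x + q = t}"
proof (rule uf_closedI)
  fix p assume p: "\<And>A. A \<in> members p \<Longrightarrow> \<exists>x\<in>{x. x + q = t}. A \<in> members x"
  have "t = p + q"
  proof (rule uf_eqI, rule ccontr)
    fix A assume A: "A \<in> members t" "A \<notin> members (p + q)"
    then have "- A \<in> members (p + q)" by (simp add: members_compl)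
    then obtain x where "x + q = t" "{z. {y. z + y \<in> - A} \<in> members q} \<in> members x"
      using p by (auto simp: members_plus)
    then have "- A \<in> members t" by (auto simp: members_plus)
    then show False using A by (simp add: members_compl)
  qed
  then show "p \<in> {x. x + q = t}" by simp
qed

text \<open>Left translations need not be continuous, but those by principal ultrafilters
  are.\<close>

lemma uf_closed_princ_fixed:
  fixes s :: "'a::semigroup_add"
  shows "uf_closed {x. princ s + x = x}"
proof (rule uf_closedI)
  fix p assume p: "\<And>A. A \<in> members p \<Longrightarrow> \<exists>x\<in>{x. princ s + x = x}. A \<in> members x"
  have "p = princ s + p"
  proof (rule uf_eqI, rule ccontr)
    fix A assume A: "A \<in> members p" "A \<notin> members (princ s + p)"
    then have "- A \<in> members (princ s + p)" by (simp add: members_compl)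
    then have "{y. s + y \<in> - A} \<in> members p" by (simp add: members_plus)
    then have "A \<inter> {y. s + y \<in> - A} \<in> members p" using A by (simp add: members_Int)
    then obtain x where x: "princ s + x = x" "A \<inter> {y. s + y \<in> - A} \<in> members x"
      using p by blast
    then have "- A \<in> members (princ s + x)" unfolding members_plus by (simp add: members_Int)
    then show False using x by (simp add: members_compl members_Int)
  qed
  then show "p \<in> {x. princ s + x = x}" by simp
qed

text \<open>An infinite set of principal ultrafilters has a nonprincipal adherent point.\<close>

lemma uf_closed_princ_finite:
  assumes "uf_closed X" "X \<subseteq> range princ" shows "finite X"
proof (rule ccontr)
  assume "infinite X"
  have X: "X = princ ` {x. princ x \<in> X}" using assms(2) by blast
  then have "infinite {x. princ x \<in> X}" using \<open>infinite X\<close> by (metis finite_imageI)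
  then obtain p where p: "p \<notin> range princ" "{x. princ x \<in> X} \<in> members p"
    using nonprinc_exists by blast
  have "p \<in> X"
  proof (rule uf_closedD[OF assms(1)])
    fix A assume "A \<in> members p"
    then have "A \<inter> {x. princ x \<in> X} \<in> members p" using p by (simp add: members_Int)
    then obtain x where "x \<in> A \<inter> {x. princ x \<in> X}" using members_nonempty by blast
    then show "\<exists>q\<in>X. A \<in> members q" by (auto intro: bexI[of _ "princ x"])
  qed
  then show False using p assms(2) by blast
qed

section \<open>Minimal closed subsemigroups and idempotents\<close>

definition closed_subsemigroup :: "'a::semigroup_add uf set \<Rightarrow> bool" where
  "closed_subsemigroup X \<longleftrightarrow> uf_closed X \<and> (\<forall>p\<in>X. \<forall>q\<in>X. p + q \<in> X)"

lemma closed_subsemigroupI: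
  "uf_closed X \<Longrightarrow> (\<And>p q. p \<in> X \<Longrightarrow> q \<in> X \<Longrightarrow> p + q \<in> X) \<Longrightarrow> closed_subsemigroup X"
  by (simp add: closed_subsemigroup_def)

lemma closed_subsemigroup_closed: "closed_subsemigroup X \<Longrightarrow> uf_closed X"
  by (simp add: closed_subsemigroup_def)

lemma closed_subsemigroup_plus:
  "closed_subsemigroup X \<Longrightarrow> p \<in> X \<Longrightarrow> q \<in> X \<Longrightarrow> p + q \<in> X"
  by (simp add: closed_subsemigroup_def)

lemma closed_subsemigroup_INT:
  "(\<And>X. X \<in> \<C> \<Longrightarrow> closed_subsemigroup X) \<Longrightarrow> closed_subsemigroup (\<Inter>\<C>)"
  unfolding closed_subsemigroup_def by (auto intro: uf_closed_INT)

lemma closed_subsemigroup_Int: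
  "closed_subsemigroup X \<Longrightarrow> closed_subsemigroup Y \<Longrightarrow> closed_subsemigroup (X \<inter> Y)"
  unfolding closed_subsemigroup_def by (auto intro: uf_closed_Int)

lemma closed_subsemigroup_translate:
  assumes "closed_subsemigroup X" "q \<in> X"
  shows "closed_subsemigroup ((\<lambda>x. x + q) ` X)" "(\<lambda>x. x + q) ` X \<subseteq> X"
proof -
  show "closed_subsemigroup ((\<lambda>x. x + q) ` X)"
  proof (rule closed_subsemigroupI)
    show "uf_closed ((\<lambda>x. x + q) ` X)"
      using assms by (intro uf_closed_plus_image closed_subsemigroup_closed)
    fix r t assume "r \<in> (\<lambda>x. x + q) ` X" "t \<in> (\<lambda>x. x + q) ` X"
    then obtain x y where xy: "r = x + q" "t = y + q" "x \<in> X" "y \<in> X" by blast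
    then have "r + t = (x + q + y) + q" by (simp add: add.assoc)
    moreover have "x + q + y \<in> X"
      using xy assms by (intro closed_subsemigroup_plus)
    ultimately show "r + t \<in> (\<lambda>x. x + q) ` X" by (rule image_eqI)
  qed
  show "(\<lambda>x. x + q) ` X \<subseteq> X"
    using assms by (auto intro: closed_subsemigroup_plus)
qed

lemma closed_subsemigroup_stabilizer:
  assumes "closed_subsemigroup X"
  shows "closed_subsemigroup {x \<in> X. x + q = q}"
proof -
  have "{x \<in> X. x + q = q} = X \<inter> {x. x + q = q}" by blast
  moreover have "closed_subsemigroup {x. x + q = q}"
    by (rule closed_subsemigroupI[OF uf_closed_plus_vimage]) (simp add: add.assoc)
  ultimately show ?thesis using assms by (simp add: closed_subsemigroup_Int)
qed

lemma closed_subsemigroup_fixed: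
  assumes "closed_subsemigroup X"
  shows "closed_subsemigroup {x \<in> X. princ s + x = x}"
proof -
  have "{x \<in> X. princ s + x = x} = X \<inter> {x. princ s + x = x}" by blast
  moreover have "closed_subsemigroup {x. princ s + x = x}"
    by (rule closed_subsemigroupI[OF uf_closed_princ_fixed]) (simp add: add.assoc[symmetric])
  ultimately show ?thesis using assms by (simp add: closed_subsemigroup_Int)
qed

text \<open>\<open>Z\<close> is what the minimal subsemigroup has to meet: \<open>UNIV\<close> in
  \<open>Ellis_Numakura\<close>, the nonprincipal ultrafilters in \<open>principal_square\<close>.
  Compactness of \<open>Z\<close> carries this through chains.\<close>

lemma minimal_closed_subsemigroup:
  assumes T: "closed_subsemigroup T" "T \<inter> Z \<noteq> {}" and Z: "uf_closed Z"
  obtains M where "closed_subsemigroup M" "M \<subseteq> T" "M \<inter> Z \<noteq> {}"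
    "\<And>N. closed_subsemigroup N \<Longrightarrow> N \<subseteq> M \<Longrightarrow> N \<inter> Z \<noteq> {} \<Longrightarrow> N = M"
proof -
  \<comment> \<open>Passing to complements turns minimality into the maximality that Zorn's lemma
    delivers.\<close>
  define \<A> where "\<A> = {Y. closed_subsemigroup (- Y) \<and> - Y \<subseteq> T \<and> - Y \<inter> Z \<noteq> {}}"
  have "\<exists>M\<in>\<A>. \<forall>X\<in>\<A>. M \<subseteq> X \<longrightarrow> X = M"
  proof (rule subset_Zorn_nonempty)
    have "- T \<in> \<A>" using T by (simp add: \<A>_def)
    then show "\<A> \<noteq> {}" by blast
  next
    fix \<C> assume ne: "\<C> \<noteq> {}" and ch: "subset.chain \<A> \<C>"
    then have sub: "\<And>X. X \<in> \<C> \<Longrightarrow> X \<in> \<A>"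
      and cmp: "\<And>X Y. X \<in> \<C> \<Longrightarrow> Y \<in> \<C> \<Longrightarrow> X \<subseteq> Y \<or> Y \<subseteq> X"
      unfolding subset_chain_def by blast+
    have eq: "- \<Union>\<C> = \<Inter>(uminus ` \<C>)" by blast
    have "closed_subsemigroup (- \<Union>\<C>)"
      unfolding eq using sub by (intro closed_subsemigroup_INT) (auto simp: \<A>_def)
    moreover have "- \<Union>\<C> \<subseteq> T"
      using ne sub unfolding \<A>_def by fast
    moreover have "\<Inter>((\<lambda>X. - X \<inter> Z) ` \<C>) \<noteq> {}"
    proof (rule uf_closed_chain)
      show "(\<lambda>X. - X \<inter> Z) ` \<C> \<noteq> {}" using ne by blast
      show "X \<subseteq> Y \<or> Y \<subseteq> X" if XY: "X \<in> (\<lambda>X. - X \<inter> Z) ` \<C>" "Y \<in> (\<lambda>X. - X \<inter> Z) ` \<C>" for X Y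
      proof -
        obtain X' Y' where "X' \<in> \<C>" "Y' \<in> \<C>" "X = - X' \<inter> Z" "Y = - Y' \<inter> Z" using XY by blast
        then show ?thesis using cmp[of X' Y'] by blast
      qed
      show "uf_closed X" "X \<noteq> {}" if "X \<in> (\<lambda>X. - X \<inter> Z) ` \<C>" for X
        using that sub Z
        by (auto simp: \<A>_def dest!: closed_subsemigroup_closed intro!: uf_closed_Int)
    qed
    then have "- \<Union>\<C> \<inter> Z \<noteq> {}" using ne by blast
    ultimately show "\<Union>\<C> \<in> \<A>" by (simp add: \<A>_def)
  qed
  then obtain M where M: "M \<in> \<A>" "\<And>X. X \<in> \<A> \<Longrightarrow> M \<subseteq> X \<Longrightarrow> X = M" by blast
  show ?thesis
  proof (rule that[of "- M"])
    show "closed_subsemigroup (- M)" "- M \<subseteq> T" "- M \<inter> Z \<noteq> {}"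
      using M(1) by (simp_all add: \<A>_def)
    fix N assume N: "closed_subsemigroup N" "N \<subseteq> - M" "N \<inter> Z \<noteq> {}"
    then have "- N \<in> \<A>" using \<open>- M \<subseteq> T\<close> by (simp add: \<A>_def)
    moreover have "M \<subseteq> - N" using N(2) by blast
    ultimately show "N = - M" using M(2)[of "- N"] by blast
  qed
qed

text \<open>In a minimal \<open>M\<close> the translate of \<open>M\<close> by \<open>e\<close> is
  all of \<open>M\<close>, so the stabilizer of \<open>e\<close> is nonempty. It is a closed
  subsemigroup, hence all of \<open>M\<close>, and thus contains \<open>e\<close>.\<close>

lemma Ellis_Numakura:
  assumes "closed_subsemigroup T" "T \<noteq> {}"
  obtains e where "e \<in> T" "e + e = e"
proof -
  obtain M where M: "closed_subsemigroup M" "M \<subseteq> T" "M \<noteq> {}"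
    "\<And>N. closed_subsemigroup N \<Longrightarrow> N \<subseteq> M \<Longrightarrow> N \<noteq> {} \<Longrightarrow> N = M"
    using minimal_closed_subsemigroup[of T UNIV] assms uf_closed_UNIV by auto
  then obtain e where e: "e \<in> M" by blast
  have "(\<lambda>x. x + e) ` M = M"
    using M(4)[OF closed_subsemigroup_translate[OF M(1) e]] e by blast
  then obtain x where "x \<in> M" "x + e = e" using e by (metis imageE)
  then have "{x \<in> M. x + e = e} \<noteq> {}" by blast
  then have "{x \<in> M. x + e = e} = M"
    by (intro M(4) closed_subsemigroup_stabilizer M(1)) auto
  then have "e + e = e" using e by blast
  then show ?thesis using that e M(2) by blast
qed

section \<open>Nonprincipal ultrafilters with a principal square\<close>

text \<open>\<open>mult_Suc x n\<close> is the sum of \<open>n + 1\<close> copies of \<open>x\<close>, as there is no neutral element.\<close>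
primrec mult_Suc :: "'a::semigroup_add \<Rightarrow> nat \<Rightarrow> 'a" where
  "mult_Suc x 0 = x"
| "mult_Suc x (Suc n) = x + mult_Suc x n"

lemma mult_Suc_add: "mult_Suc x m + mult_Suc x n = mult_Suc x (Suc (m + n))"
  by (induction m) (simp_all add: add.assoc)

lemma mult_Suc_mult: "mult_Suc (mult_Suc x m) n = mult_Suc x (m + n * Suc m)"
  by (induction n) (simp_all add: mult_Suc_add algebra_simps)

lemma mult_Suc_right: "mult_Suc x n + x = mult_Suc x (Suc n)"
  using mult_Suc_add[of x n 0] by simp

text \<open>If no nonprincipal \<open>p\<close> had a principal square, then by minimality the right translation
  by a nonprincipal \<open>q\<close> would be onto M, an idempotent \<open>f\<close> with \<open>f + q = q\<close> would be an identity
  of M, and \<open>q\<close> would be invertible. As \<open>f\<close> is isolated, this would make \<open>q\<close> principal.\<close>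
lemma minimal_principal_square:
  assumes M: "closed_subsemigroup M"
    and min: "\<And>N. closed_subsemigroup N \<Longrightarrow> N \<subseteq> M \<Longrightarrow> N \<inter> - range princ \<noteq> {} \<Longrightarrow> N = M"
    and idem: "\<And>q. q \<in> M \<Longrightarrow> q + q = q \<Longrightarrow> q \<in> range princ"
    and ne: "M \<inter> - range princ \<noteq> {}"
  shows "\<exists>p\<in>M. p \<notin> range princ \<and> p + p \<in> range princ"
proof (rule ccontr)
  assume "\<not> ?thesis"
  then have sq: "\<And>p. p \<in> M \<Longrightarrow> p \<notin> range princ \<Longrightarrow> p + p \<notin> range princ" by blast
  obtain q where q: "q \<in> M" "q \<notin> range princ" using ne by blast
  \<comment> \<open>The translate contains \<open>q + q\<close>, which is nonprincipal by
    \<open>sq\<close>.\<close>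
  have Mq: "(\<lambda>x. x + q) ` M = M"
    using sq[OF q] q(1)
    by (intro min closed_subsemigroup_translate M q(1)) auto
  \<comment> \<open>The idempotent \<open>g\<close> is principal, so its fixed points form a closed
    subsemigroup; it contains the nonprincipal \<open>q\<close>.\<close>
  have left_id: "g + x = x" if g: "g \<in> M" "g + g = g" "g + q = q" and x: "x \<in> M" for g x
  proof -
    obtain s where s: "g = princ s" using idem g by blast
    have "{x \<in> M. princ s + x = x} = M"
      using q g(3) by (intro min closed_subsemigroup_fixed M) (auto simp: s)
    then show ?thesis using x s by blast
  qed
  obtain x where "x \<in> M" "x + q = q" using q(1) Mq by (metis imageE)
  then have "{x \<in> M. x + q = q} \<noteq> {}" by blast
  then obtain f where f: "f \<in> M" "f + q = q" "f + f = f"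
    using Ellis_Numakura[OF closed_subsemigroup_stabilizer[OF M]] by blast
  have right_id: "x + f = x" if "x \<in> M" for x
  proof -
    have "(\<lambda>x. x + f) ` M = M"
    \<comment> \<open>If the translate by \<open>f\<close> had only principal elements, it would be
      finite. Translating it by \<open>q\<close> gives \<open>M\<close>, so \<open>M\<close> would
      have no more elements than its proper subset.\<close>
    proof (cases "(\<lambda>x. x + f) ` M \<subseteq> range princ")
      case True
      let ?D = "(\<lambda>x. x + f) ` M"
      have fin: "finite ?D"
        using True by (intro uf_closed_princ_finite closed_subsemigroup_closed
          closed_subsemigroup_translate M f)
      have "M = (\<lambda>x. x + q) ` ?D"
        using Mq f(2) by (simp add: image_image add.assoc)
      then have "finite M" "card M \<le> card ?D"
        using fin by (metis finite_imageI, metis card_image_le)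
      moreover have "?D \<subset> M"
        using closed_subsemigroup_translate(2)[OF M f(1)] True q by blast
      ultimately show ?thesis by (meson leD psubset_card_mono)
    next
      case False
      then show ?thesis
        by (intro min closed_subsemigroup_translate M f(1)) auto
    qed
    then have "x \<in> (\<lambda>x. x + f) ` M" using that by (rule ssubst)
    then obtain y where "x = y + f" by blast
    then show ?thesis using f(3) by (simp add: add.assoc)
  qed
  have "f \<in> (\<lambda>x. x + q) ` M" using Mq f(1) by (rule ssubst)
  then obtain x where x: "x \<in> M" "x + q = f" by blast
  \<comment> \<open>\<open>x\<close> is a left inverse of \<open>q\<close>. Then
    \<open>q + x\<close> is an idempotent fixing \<open>q\<close>, hence a left identity, and equals
    \<open>f\<close>.\<close>
  have "q + x \<in> M" using q x M by (intro closed_subsemigroup_plus)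
  moreover have "(q + x) + (q + x) = q + ((x + q) + x)" by (simp add: add.assoc)
  then have "(q + x) + (q + x) = q + x" using x left_id[OF f(1) f(3) f(2)] by simp
  moreover have "q + x + q = q"
    using x right_id[OF q(1)] by (simp add: add.assoc)
  ultimately have "q + x + f = f" using left_id f(1) by blast
  then have "q + x = f" using right_id[OF \<open>q + x \<in> M\<close>] by simp
  \<comment> \<open>As \<open>f\<close> is isolated, some \<open>princ y\<close> replaces
    \<open>q\<close> in \<open>q + x = f\<close>; adding \<open>q\<close> on the right gives
    \<open>q = princ y + f\<close>, which is principal.\<close>
  moreover obtain s where s: "f = princ s" using idem f by blast
  ultimately have "{y. princ y + x = princ s} \<in> members q" by (simp add: plus_eq_princD)
  then obtain y where y: "princ y + x = f" using members_nonempty s by blast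
  have "q = f + q" using f(2) by simp
  also have "\<dots> = princ y + (x + q)" by (simp add: y[symmetric] add.assoc)
  also have "\<dots> = princ (y + s)" by (simp add: x(2) s princ_plus_princ)
  finally show False using q(2) by blast
qed

text \<open>Minimality supplies \<open>p\<close>. The idempotent multiple of \<open>s\<close> comes
  from \<open>Ellis_Numakura\<close>, applied to those elements of \<open>T\<close> that contain the
  set of multiples of \<open>s\<close>.\<close>

lemma principal_square:
  fixes T :: "'a::semigroup_add uf set"
  assumes T: "closed_subsemigroup T" and ne: "T \<inter> - range princ \<noteq> {}"
    and idem: "\<And>q. q \<in> T \<Longrightarrow> q + q = q \<Longrightarrow> q \<in> range princ"
  obtains p :: "'a uf" and s n where "p \<notin> range princ" "p + p = princ s"
    "mult_Suc s n + mult_Suc s n = mult_Suc s n"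
proof -
  obtain M where M: "closed_subsemigroup M" "M \<subseteq> T" "M \<inter> - range princ \<noteq> {}"
    "\<And>N. closed_subsemigroup N \<Longrightarrow> N \<subseteq> M \<Longrightarrow> N \<inter> - range princ \<noteq> {} \<Longrightarrow> N = M"
    using minimal_closed_subsemigroup[OF T ne uf_closed_nonprinc] by blast
  obtain p s where p: "p \<in> M" "p \<notin> range princ" "p + p = princ s"
    using minimal_principal_square[OF M(1) M(4) _ M(3)] idem M(2) by blast
  have "closed_subsemigroup {q. range (mult_Suc s) \<in> members q}"
  proof (rule closed_subsemigroupI[OF uf_closed_members])
    fix q r assume "q \<in> {q. range (mult_Suc s) \<in> members q}" "r \<in> {q. range (mult_Suc s) \<in> members q}"
    then have "range (mult_Suc s) \<in> members (q + r)"
      by (intro members_plusI[of "range (mult_Suc s)"])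
        (auto simp: mult_Suc_add simp del: mult_Suc.simps elim!: members_mono)
    then show "q + r \<in> {q. range (mult_Suc s) \<in> members q}" by simp
  qed
  then have "closed_subsemigroup (T \<inter> {q. range (mult_Suc s) \<in> members q})"
    using T by (rule closed_subsemigroup_Int[rotated])
  moreover have "princ s \<in> T"
    using p M T closed_subsemigroup_plus by (metis subsetD)
  then have "princ s \<in> T \<inter> {q. range (mult_Suc s) \<in> members q}"
    using rangeI[of "mult_Suc s" 0] by simp
  ultimately obtain e where e: "e \<in> T" "range (mult_Suc s) \<in> members e" "e + e = e"
    using Ellis_Numakura[of "T \<inter> {q. range (mult_Suc s) \<in> members q}"] by blast
  then obtain v where v: "e = princ v" using idem by blast
  then obtain n where "v = mult_Suc s n" using e by auto
  moreover have "v + v = v" using e(3) v by (simp add: princ_plus_princ)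
  ultimately show ?thesis using that[OF p(2,3)] by simp
qed

section \<open>Recognizing the three types\<close>

lemma has_type_aI:
  fixes Y :: "'a::semigroup_add set"
  assumes "infinite Y" "finite \<Phi>"
    and "\<And>x y. x \<in> Y \<Longrightarrow> y \<in> Y \<Longrightarrow> x + y \<in> \<Phi>"
    and "\<And>x y. x \<in> Y \<Longrightarrow> y \<in> \<Phi> \<Longrightarrow> x + y \<in> \<Phi>"
    and "\<And>x y. x \<in> \<Phi> \<Longrightarrow> y \<in> Y \<Longrightarrow> x + y \<in> \<Phi>"
    and "\<And>x y. x \<in> \<Phi> \<Longrightarrow> y \<in> \<Phi> \<Longrightarrow> x + y \<in> \<Phi>"
  shows "has_type_a TYPE('a)"
proof -
  have *: "x + y \<in> \<Phi>" if "x \<in> Y \<union> \<Phi>" "y \<in> Y \<union> \<Phi>" for x y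
    using that assms(3-6) by blast
  have "finite {x + y | x y. x \<in> Y \<union> \<Phi> \<and> y \<in> Y \<union> \<Phi>}"
    by (rule finite_subset[OF _ assms(2)]) (use * in blast)
  then show ?thesis
    unfolding has_type_a_def using * assms(1) by (intro exI[of _ "Y \<union> \<Phi>"]) simp
qed

text \<open>The multiples are eventually periodic; one whose number of copies is a large enough
  multiple of the period is idempotent.\<close>

lemma mult_Suc_not_inj_idem:
  assumes "\<not> inj (mult_Suc x)"
  shows "\<exists>n. mult_Suc x n + mult_Suc x n = mult_Suc x n"
proof -
  obtain i j where ij: "mult_Suc x i = mult_Suc x j" "i < j"
    using assms by (metis injI linorder_neqE_nat)
  define d where "d = j - i"
  have d: "d > 0" using ij by (simp add: d_def)
  have period: "mult_Suc x (n + d) = mult_Suc x n" if "n \<ge> i" for n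
  proof (cases "n = i")
    case True
    then show ?thesis using ij by (simp add: d_def)
  next
    case False
    then obtain k where k: "n = Suc (i + k)" using \<open>n \<ge> i\<close> by (metis le_neq_implies_less less_imp_Suc_add)
    then have "n + d = Suc (j + k)" using ij by (simp add: d_def)
    then show ?thesis using k ij(1) by (metis mult_Suc_add)
  qed
  have periods: "mult_Suc x (n + t * d) = mult_Suc x n" if "n \<ge> i" for n t
  proof (induction t)
    case (Suc t)
    then show ?case using period[of "n + t * d"] that by (simp add: algebra_simps)
  qed simp
  \<comment> \<open>\<open>mult_Suc x n\<close> has \<open>n + 1\<close> copies, so it is
    \<open>n + 1\<close> that has to be a multiple of \<open>d\<close>.\<close>
  define n where "n = Suc i * d - 1"
  have n: "Suc n = Suc i * d" using d by (simp add: n_def)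
  moreover have "Suc i * 1 \<le> Suc i * d" using d by (intro mult_le_mono2) simp
  ultimately have "n \<ge> i" by simp
  then have "mult_Suc x (n + Suc n) = mult_Suc x n" unfolding n by (rule periods)
  then show ?thesis using mult_Suc_add[of x n n] by auto
qed

text \<open>Elements of B none of whose multiples lie in \<open>\<Phi>\<close> lead to type (c) if they have infinite order,
  and to type (b), through their idempotent multiples, if they have finite order. If \<open>x\<close> has
  multiples in \<open>\<Phi>\<close>, the least multiple \<open>c x\<close> of \<open>x\<close> with \<open>c x + c x \<in> \<Phi>\<close> leads to type (a).\<close>
lemma finite_ideal_types:
  fixes B \<Phi> :: "'a::semigroup_add set"
  assumes infB: "infinite B" and fin: "finite \<Phi>"
    and BB: "\<And>x y. x \<in> B \<Longrightarrow> y \<in> B \<Longrightarrow> x \<noteq> y \<Longrightarrow> x + y \<in> \<Phi>"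
    and BP: "\<And>x y. x \<in> B \<Longrightarrow> y \<in> \<Phi> \<Longrightarrow> x + y \<in> \<Phi>"
    and PB: "\<And>x y. x \<in> \<Phi> \<Longrightarrow> y \<in> B \<Longrightarrow> x + y \<in> \<Phi>"
    and PP: "\<And>x y. x \<in> \<Phi> \<Longrightarrow> y \<in> \<Phi> \<Longrightarrow> x + y \<in> \<Phi>"
    and e: "\<And>x y. x \<in> B \<Longrightarrow> y \<in> B \<Longrightarrow> x \<noteq> y \<Longrightarrow> mult_Suc x r + mult_Suc y r = e"
    and e_left: "\<And>x. x \<in> B \<Longrightarrow> e + mult_Suc x r = e"
    and e_right: "\<And>x. x \<in> B \<Longrightarrow> mult_Suc x r + e = e"
  shows "has_type_a TYPE('a) \<or> has_type_b TYPE('a) \<or> has_type_c TYPE('a)"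
proof -
  have MP: "mult_Suc x n + y \<in> \<Phi>" if "x \<in> B" "y \<in> \<Phi>" for x y n
    using that by (induction n) (auto simp: add.assoc BP)
  have PM: "y + mult_Suc x n \<in> \<Phi>" if "x \<in> B" "y \<in> \<Phi>" for x y n
    using that by (induction n arbitrary: y) (auto simp: add.assoc[symmetric] PB)
  have BM: "x + mult_Suc y n \<in> \<Phi>" if "x \<in> B" "y \<in> B" "x \<noteq> y" for x y n
    using that by (cases n) (auto simp: add.assoc[symmetric] BB PM)
  have MM: "mult_Suc x m + mult_Suc y n \<in> \<Phi>" if "x \<in> B" "y \<in> B" "x \<noteq> y" for x y m n
    using that by (induction m) (auto simp: add.assoc BM BP)
  have up: "mult_Suc x n' \<in> \<Phi>" if x: "x \<in> B" "mult_Suc x n \<in> \<Phi>" "n \<le> n'" for x n n'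
  proof (cases "n = n'")
    case False
    then obtain k where "n' = Suc (n + k)" using x(3) by (metis le_neq_implies_less less_imp_Suc_add)
    then show ?thesis using PM[OF x(1,2), of k] by (simp add: mult_Suc_add)
  qed (use x in simp)
  \<comment> \<open>Adding one more \<open>x\<close> to the common value gives a sum mixing
    \<open>y\<close> and \<open>x\<close>, which lies in \<open>\<Phi>\<close>.\<close>
  have clash: "mult_Suc x (Suc m) \<in> \<Phi>"
    if "x \<in> B" "y \<in> B" "x \<noteq> y" "mult_Suc x m = mult_Suc y n" for x y m n
    using MM[of y x n 0] that mult_Suc_right[of x m] by simp
  obtain x0 y0 where xy0: "x0 \<in> B" "y0 \<in> B" "x0 \<noteq> y0"
    using infB by (metis finite.simps is_singletonI' is_singleton_the_elem infinite_imp_nonempty)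
  have e_in: "e \<in> \<Phi>" using MM[OF xy0] e[OF xy0] by metis
  have ee: "e + e = e"
    using e[OF xy0] e_left[OF xy0(1)] e_left[OF xy0(2)] by (metis add.assoc)
  have eM: "e + mult_Suc (mult_Suc x r) n = e" if "x \<in> B" for x n
    using that by (induction n) (auto simp: add.assoc[symmetric] e_left)
  have Me: "mult_Suc (mult_Suc x r) n + e = e" if "x \<in> B" for x n
    using that by (induction n) (auto simp: add.assoc e_right)
  have cross1: "mult_Suc x r + mult_Suc (mult_Suc y r) n = e"
    if "x \<in> B" "y \<in> B" "x \<noteq> y" for x y n
    using that by (cases n) (auto simp: add.assoc[symmetric] e eM)
  have cross: "mult_Suc (mult_Suc x r) m + mult_Suc (mult_Suc y r) n = e"
    if "x \<in> B" "y \<in> B" "x \<noteq> y" for x y m n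
    using that by (induction m) (auto simp: add.assoc cross1 e_right)
  define K where "K = {x \<in> B. \<exists>n. mult_Suc x n \<in> \<Phi>}"
  define C where "C = {x \<in> B. (\<forall>n. mult_Suc x n \<notin> \<Phi>) \<and> inj (mult_Suc x)}"
  define D where "D = {x \<in> B. (\<forall>n. mult_Suc x n \<notin> \<Phi>) \<and> \<not> inj (mult_Suc x)}"
  have "B = K \<union> C \<union> D" by (auto simp: K_def C_def D_def)
  then consider "infinite K" | "infinite C" | "infinite D" using infB by auto
  then show ?thesis
  proof cases
    case 1
    \<comment> \<open>The index \<open>Suc (2 * n)\<close> means \<open>2 * n + 2\<close> copies,
      the double of \<open>mult_Suc x n\<close>.\<close>
    define k where "k x = (LEAST n. mult_Suc x (Suc (2 * n)) \<in> \<Phi>)" for x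
    have k: "mult_Suc x (Suc (2 * k x)) \<in> \<Phi>" if x: "x \<in> K" for x
    proof -
      obtain n where "mult_Suc x n \<in> \<Phi>" "x \<in> B" using x by (auto simp: K_def)
      then have "mult_Suc x (Suc (2 * n)) \<in> \<Phi>" using up[of x n "Suc (2 * n)"] by simp
      then show ?thesis unfolding k_def by (rule LeastI)
    qed
    have k_least: "mult_Suc x (Suc (2 * n)) \<notin> \<Phi>" if "n < k x" for x n
      using that unfolding k_def by (rule not_less_Least)
    have KB: "x \<in> B" if "x \<in> K" for x using that by (simp add: K_def)
    define c where "c x = mult_Suc x (k x)" for x
    have cc: "c x + c x \<in> \<Phi>" if "x \<in> K" for x
      using k[OF that] by (simp add: c_def mult_Suc_add mult_2 del: mult_Suc.simps)
    show ?thesis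
    proof (cases "finite (c ` K)")
      case False
      have "has_type_a TYPE('a)"
      proof (rule has_type_aI[OF False fin])
        show "x + y \<in> \<Phi>" if "x \<in> c ` K" "y \<in> c ` K" for x y
        proof -
          obtain x' y' where "x = c x'" "y = c y'" "x' \<in> K" "y' \<in> K" using \<open>x \<in> c ` K\<close> \<open>y \<in> c ` K\<close> by blast
          then show ?thesis using cc MM KB by (cases "x' = y'") (auto simp: c_def)
        qed
        show "x + y \<in> \<Phi>" if "x \<in> c ` K" "y \<in> \<Phi>" for x y
          using that MP KB by (auto simp: c_def)
        show "x + y \<in> \<Phi>" if "x \<in> \<Phi>" "y \<in> c ` K" for x y
          using that PM KB by (auto simp: c_def)
      qed (rule PP)
      then show ?thesis ..
    next
      case True
      obtain x1 where x1: "infinite {x \<in> K. c x = c x1}"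
        using pigeonhole_infinite[OF 1 True] by blast
      define c1 where "c1 = c x1"
      \<comment> \<open>Removing \<open>c1\<close> ensures \<open>k x \<noteq> 0\<close> on
        \<open>N\<close>.\<close>
      define N where "N = {x \<in> K. c x = c1} - {c1}"
      have infN: "infinite N" using x1 by (simp add: N_def c1_def)
      \<comment> \<open>Since \<open>x\<close> shares \<open>c1\<close> with another element,
        \<open>clash\<close> puts \<open>k x + 2\<close> copies of \<open>x\<close> into
        \<open>\<Phi>\<close>. For \<open>k x \<ge> 2\<close> this contradicts the leastness of
        \<open>k x\<close>, so \<open>k x = 1\<close>.\<close>
      have N: "x + x = c1 \<and> mult_Suc x 2 \<in> \<Phi> \<and> x \<in> B" if x: "x \<in> N" for x
      proof -
        have "infinite (N - {x})" using infN by simp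
        then obtain y where y: "y \<in> N" "y \<noteq> x" using infinite_imp_nonempty by blast
        have xB: "x \<in> B" "y \<in> B" using x y KB by (auto simp: N_def)
        have eq: "mult_Suc x (k x) = c1" "mult_Suc y (k y) = c1" using x y by (auto simp: N_def c_def)
        then have *: "mult_Suc x (Suc (k x)) \<in> \<Phi>"
          using clash[OF xB y(2)[symmetric]] by metis
        have "x \<noteq> c1" using x by (simp add: N_def)
        then have "k x \<noteq> 0" using eq(1) by (metis mult_Suc.simps(1))
        moreover have "\<not> k x \<ge> 2"
        proof
          assume "k x \<ge> 2"
          then have "mult_Suc x (Suc (2 * (k x - 1))) \<in> \<Phi>"
            by (intro up[OF xB(1) *]) simp
          then show False using k_least[of "k x - 1" x] \<open>k x \<ge> 2\<close> by simp
        qed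
        ultimately have "k x = 1" by simp
        then show ?thesis using eq(1) * xB by (simp add: numeral_2_eq_2)
      qed
      obtain x2 where x2: "x2 \<in> N" using infN infinite_imp_nonempty by blast
      then have c1: "c1 = mult_Suc x2 1" using N by simp
      have "has_type_a TYPE('a)"
      proof (rule has_type_aI[OF infN, of "insert c1 \<Phi>"])
        show "finite (insert c1 \<Phi>)" using fin by simp
        show "x + y \<in> insert c1 \<Phi>" if "x \<in> N" "y \<in> N" for x y
          using that N BB by (cases "x = y") auto
        have 3: "x + c1 \<in> \<Phi> \<and> c1 + x \<in> \<Phi>" if "x \<in> N" for x
          using N[OF that] by (auto simp: numeral_2_eq_2 add.assoc)
        show "x + y \<in> insert c1 \<Phi>" if "x \<in> N" "y \<in> insert c1 \<Phi>" for x y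
          using that 3 N BP by auto
        show "x + y \<in> insert c1 \<Phi>" if "x \<in> insert c1 \<Phi>" "y \<in> N" for x y
          using that 3 N PB by auto
        have "c1 + c1 = mult_Suc x2 3" by (simp add: c1 mult_Suc_add numeral_3_eq_3 del: mult_Suc.simps)
        then have "c1 + c1 \<in> \<Phi>" using N[OF x2] up[of x2 2 3] by simp
        then show "x + y \<in> insert c1 \<Phi>" if "x \<in> insert c1 \<Phi>" "y \<in> insert c1 \<Phi>" for x y
          using that N[OF x2] PP MP[of x2] PM[of x2] unfolding c1 by blast
      qed
      then show ?thesis ..
    qed
  next
    case 2
    then obtain x :: "nat \<Rightarrow> 'a" where x: "inj x" "range x \<subseteq> C"
      using infinite_countable_subset by blast
    have xB: "x m \<in> B" and x_out: "mult_Suc (x m) n \<notin> \<Phi>" and x_inj: "inj (mult_Suc (x m))" for m n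
      using x(2) by (auto simp: C_def)
    \<comment> \<open>Multiples of \<open>mult_Suc x r\<close> are used because mixed sums of these
      equal \<open>e\<close>; the second coordinate \<open>n\<close> means \<open>n\<close> copies,
      hence \<open>n - 1\<close>.\<close>
    define g where "g = (\<lambda>(m, n). mult_Suc (mult_Suc (x m) r) (n - 1))"
    let ?P = "{p::nat\<times>nat. fst p \<ge> 1 \<and> snd p \<ge> 1}"
    have x_neq: "x m \<noteq> x n" if "m \<noteq> n" for m n using that x(1) by (auto dest: injD)
    have "inj_on g ?P"
    proof (rule inj_onI)
      fix p q assume pq: "p \<in> ?P" "q \<in> ?P" "g p = g q"
      obtain m n m' n' where [simp]: "p = (m, n)" "q = (m', n')" by fastforce
      have eq: "mult_Suc (x m) (r + (n - 1) * Suc r) = mult_Suc (x m') (r + (n' - 1) * Suc r)"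
        using pq(3) by (simp add: g_def mult_Suc_mult)
      have "m = m'"
        using clash[OF xB xB x_neq eq] x_out by metis
      then have "r + (n - 1) * Suc r = r + (n' - 1) * Suc r"
        using eq x_inj[of m] by (simp only: inj_eq)
      then have "(n - 1) * Suc r = (n' - 1) * Suc r" by (simp only: add_left_cancel)
      then have "n - 1 = n' - 1" by (simp only: mult_cancel2) simp
      then have "n = n'" using pq(1,2) by (cases n; cases n') auto
      then show "p = q" using \<open>m = m'\<close> by simp
    qed
    moreover have "e \<notin> g ` ?P"
      using e_in x_out by (auto simp: g_def mult_Suc_mult)
    moreover have "g (m, n1) + g (m, n2) = g (m, n1 + n2)" if "n1 \<ge> 1" "n2 \<ge> 1" for m n1 n2
      using that by (simp add: g_def mult_Suc_add Suc_diff_Suc del: mult_Suc.simps)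
    ultimately have "has_type_c TYPE('a)"
      unfolding has_type_c_def
      by (intro exI[of _ e] exI[of _ g]) (auto simp: g_def ee eM Me xB cross x_neq)
    then show ?thesis by simp
  next
    case 3
    have "\<exists>n. mult_Suc x n + mult_Suc x n = mult_Suc x n" if "x \<in> D" for x
      using that mult_Suc_not_inj_idem by (auto simp: D_def)
    then obtain k where k: "\<And>x. x \<in> D \<Longrightarrow> mult_Suc x (k x) + mult_Suc x (k x) = mult_Suc x (k x)"
      by metis
    define u where "u x = mult_Suc x (k x)" for x
    \<comment> \<open>An idempotent absorbs repetition, so \<open>u x\<close> is also a multiple of
      \<open>mult_Suc x r\<close>, and \<open>cross\<close>, \<open>eM\<close> and \<open>Me\<close>
      apply to it.\<close>
    have u: "u x = mult_Suc (mult_Suc x r) (k x)" if "x \<in> D" for x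
    proof -
      have "mult_Suc (u x) n = u x" for n
        by (induction n) (use k[OF that] in \<open>simp_all add: u_def\<close>)
      then have "u x = mult_Suc (mult_Suc x (k x)) r" by (simp add: u_def)
      then show ?thesis by (simp add: mult_Suc_mult algebra_simps)
    qed
    from 3 obtain x :: "nat \<Rightarrow> 'a" where x: "inj x" "range x \<subseteq> D"
      using infinite_countable_subset by blast
    have xD: "x m \<in> D" and xB: "x m \<in> B" and x_out: "mult_Suc (x m) n \<notin> \<Phi>" for m n
      using x(2) by (auto simp: D_def)
    have x_neq: "x m \<noteq> x n" if "m \<noteq> n" for m n using that x(1) by (auto dest: injD)
    have u_neq: "u (x m) \<noteq> u (x n)" if "m \<noteq> n" for m n
      using clash[OF xB xB x_neq[OF that]] x_out unfolding u_def by metis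
    have u_e: "u (x m) \<noteq> e" for m using e_in x_out unfolding u_def by metis
    have ux: "u (x m) + u (x n) = e" if "m \<noteq> n" for m n
      using cross[OF xB xB x_neq[OF that]] by (simp add: u[OF xD])
    have ue: "u (x m) + e = e" "e + u (x m) = e" for m
      using Me[OF xB] eM[OF xB] by (simp_all add: u[OF xD])
    have uu: "u (x m) + u (x m) = u (x m)" for m using k[OF xD] by (simp add: u_def)
    define f where "f n = (if n = 1 then e else u (x n))" for n :: nat
    have "inj_on f {1..}"
      using u_neq u_e by (intro inj_onI) (metis f_def)
    then have "has_type_b TYPE('a)"
      unfolding has_type_b_def
      by (intro exI[of _ f]) (auto simp: f_def ee ux ue uu)
    then show ?thesis by simp
  qed
qed

section \<open>Sequences with constant ascending sums\<close>

text \<open>In the situation below, \<open>\<sigma> k\<close> is the common value of all sums of \<open>k + 2\<close>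
  terms of \<open>b\<close> having somewhere an index followed by a larger one.\<close>

locale ascending_sums =
  fixes b :: "nat \<Rightarrow> 'a::semigroup_add" and \<sigma> :: "nat \<Rightarrow> 'a"
  assumes inj: "inj b"
    and asc: "i < j \<Longrightarrow> b i + b j = \<sigma> 0"
    and left: "b i + \<sigma> k = \<sigma> (Suc k)"
    and right: "\<sigma> k + b i = \<sigma> (Suc k)"
begin

text \<open>The offset counts terms: \<open>(k + 2) + (l + 2) = (k + l + 2) + 2\<close>.\<close>

lemma sigma_add: "\<sigma> k + \<sigma> l = \<sigma> (k + l + 2)"
proof (induction l)
  case 0
  have "\<sigma> k + \<sigma> 0 = (\<sigma> k + b 0) + b 1" using asc[of 0 1] by (simp add: add.assoc)
  then show ?case by (simp add: right)
next
  case (Suc l)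
  have "\<sigma> k + \<sigma> (Suc l) = (\<sigma> k + \<sigma> l) + b 0" by (simp add: right[of l 0, symmetric] add.assoc)
  then show ?case by (simp add: Suc right)
qed

lemma mult_left: "mult_Suc (b i) n + \<sigma> k = \<sigma> (Suc (n + k))"
  by (induction n) (simp_all add: add.assoc left)

lemma mult_right: "\<sigma> k + mult_Suc (b i) n = \<sigma> (Suc (n + k))"
proof (induction n arbitrary: k)
  case (Suc n)
  then show ?case by (simp add: add.assoc[symmetric] right)
qed (simp add: right)

lemma mult_asc:
  assumes "i < j" shows "mult_Suc (b i) m + mult_Suc (b j) n = \<sigma> (m + n)"
proof (induction m)
  case 0
  show ?case
    using asc[OF assms] by (cases n) (simp_all add: add.assoc[symmetric] mult_right)
next
  case (Suc m)
  then show ?case by (simp add: add.assoc left)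
qed

text \<open>Regrouping exposes the ascent \<open>b i + b l\<close> in the middle, which absorbs the
  outer terms.\<close>

lemma desc_add_desc:
  assumes "i < l" shows "(b j + b i) + (b l + b k) = \<sigma> 2"
proof -
  have "(b j + b i) + (b l + b k) = b j + ((b i + b l) + b k)" by (simp add: add.assoc)
  then show ?thesis by (simp add: asc[OF assms] left right numeral_2_eq_2)
qed

lemma desc_sigma: "(b j + b i) + \<sigma> k = \<sigma> (k + 2)" "\<sigma> k + (b j + b i) = \<sigma> (k + 2)"
  by (simp add: add.assoc left) (simp add: add.assoc[symmetric] right)

text \<open>The condition \<open>i < l\<close> provides an ascent in the sum of any two elements of
  \<open>Y\<close>, equal or not, so all sums fall into \<open>range \<sigma>\<close>.\<close>

lemma type_a_of_descending:
  assumes "finite (range \<sigma>)" "infinite Y"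
    and "\<And>x y. x \<in> Y \<Longrightarrow> y \<in> Y \<Longrightarrow> \<exists>i j k l. i < l \<and> x = b j + b i \<and> y = b l + b k"
  shows "has_type_a TYPE('a)"
proof (rule has_type_aI[OF assms(2,1)])
  have Y: "\<exists>i j. x = b j + b i" if "x \<in> Y" for x using assms(3) that by blast
  show "x + y \<in> range \<sigma>" if "x \<in> Y" "y \<in> Y" for x y
    using assms(3)[OF that] desc_add_desc by force
  show "x + y \<in> range \<sigma>" if "x \<in> Y" "y \<in> range \<sigma>" for x y
    using Y[OF that(1)] that(2) desc_sigma by force
  show "x + y \<in> range \<sigma>" if "x \<in> range \<sigma>" "y \<in> Y" for x y
    using Y[OF that(2)] that(1) desc_sigma by force
  show "x + y \<in> range \<sigma>" if "x \<in> range \<sigma>" "y \<in> range \<sigma>" for x y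
    using that sigma_add by force
qed

lemma subsequence: "strict_mono h \<Longrightarrow> ascending_sums (b \<circ> h) \<sigma>"
  using inj asc left right strict_mono_less[of h]
  by unfold_locales (auto simp: inj_compose strict_mono_imp_inj_on)

text \<open>\<open>V\<close> collects the values that \<open>b j + b i\<close> takes infinitely
  often for a fixed \<open>i\<close>. If \<open>V\<close> is infinite, or some \<open>i\<close>
  admits infinitely many values, type (a) arises. Otherwise a sparse subsequence has all its
  descending sums in the finite set \<open>V\<close>.\<close>

lemma descending_cases:
  assumes fin: "finite (range \<sigma>)"
  shows "has_type_a TYPE('a) \<or> (\<exists>h :: nat \<Rightarrow> nat. strict_mono h \<and>
    finite {b (h j) + b (h i) | i j. i < j} \<and>
    (\<forall>i j k. i < j \<longrightarrow> b (h j) + b (h i) + b (h k) = \<sigma> 1 \<and>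
      b (h k) + (b (h j) + b (h i)) = \<sigma> 1))"
proof -
  define V where "V = {v. \<exists>i. infinite {j. b j + b i = v}}"
  have V: "\<exists>i j. n < j \<and> v = b j + b i \<and> infinite {j. b j + b i = v}" if v: "v \<in> V" for v n
  proof -
    obtain i where i: "infinite {j. b j + b i = v}" using v by (auto simp: V_def)
    then obtain j where "n < j" "j \<in> {j. b j + b i = v}" using infinite_nat_iff_unbounded by blast
    then show ?thesis using i by auto
  qed
  consider (1) i where "infinite ((\<lambda>j. b j + b i) ` {i<..})" | (2) "infinite V"
    | (3) "finite V" "\<And>i. finite ((\<lambda>j. b j + b i) ` {i<..})" by blast
  then show ?thesis
  proof cases
    case 1
    have "has_type_a TYPE('a)" by (rule type_a_of_descending[OF fin 1]) blast
    then show ?thesis ..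
  next
    case 2
    have "has_type_a TYPE('a)"
    proof (rule type_a_of_descending[OF fin 2])
      fix x y assume xy: "x \<in> V" "y \<in> V"
      obtain i j where "x = b j + b i" using V[OF xy(1)] by blast
      then show "\<exists>i j k l. i < l \<and> x = b j + b i \<and> y = b l + b k" using V[OF xy(2), of i] by blast
    qed
    then show ?thesis ..
  next
    case 3
    \<comment> \<open>Infinitely many exceptions would take only finitely many values, so one value
      would recur infinitely often and belong to \<open>V\<close>.\<close>
    have "\<exists>J. \<forall>j\<ge>J. b j + b i \<in> V" for i
    proof (rule ccontr)
      assume no: "\<not> ?thesis"
      let ?X = "{j. b j + b i \<notin> V \<and> i < j}"
      have "\<exists>j>m. b j + b i \<notin> V \<and> i < j" for m
        using no by (metis Suc_le_eq add_leD1 add_leD2 add_Suc_right add_Suc)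
      then have "infinite ?X" unfolding infinite_nat_iff_unbounded by simp
      moreover have "finite ((\<lambda>j. b j + b i) ` ?X)"
        by (rule finite_subset[OF _ 3(2)[of i]]) auto
      ultimately obtain j where j: "j \<in> ?X" "infinite {k \<in> ?X. b k + b i = b j + b i}"
        using pigeonhole_infinite[of ?X "\<lambda>j. b j + b i"] by auto
      then have "infinite {k. b k + b i = b j + b i}"
        by (rule_tac infinite_super[OF _ j(2)]) auto
      then show False using j(1) by (auto simp: V_def)
    qed
    then obtain J where J: "\<And>i j. j \<ge> J i \<Longrightarrow> b j + b i \<in> V" by metis
    have "\<exists>i. infinite {j. b j + b i = v}" if "v \<in> V" for v using that by (simp add: V_def)
    then obtain w where w: "\<And>v. v \<in> V \<Longrightarrow> infinite {j. b j + b (w v) = v}" by metis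
    define N where "N = Suc (\<Sum>v\<in>V. w v)"
    have N: "w v < N" if "v \<in> V" for v
      using member_le_sum[OF that, of w] 3(1) by (simp add: N_def)
    \<comment> \<open>Starts above all \<open>w v\<close> and lets each term exceed the thresholds
      \<open>J i\<close> of all indices up to the previous term.\<close>
    define h where "h = rec_nat N (\<lambda>_ m. Suc (m + (\<Sum>i\<le>m. J i)))"
    have h: "h 0 = N" "h (Suc n) = Suc (h n + (\<Sum>i\<le>h n. J i))" for n by (simp_all add: h_def)
    have mono: "strict_mono h" by (simp add: strict_mono_Suc_iff h)
    have hV: "b (h j) + b (h i) \<in> V" if ij: "i < j" for i j
    proof -
      obtain n where n: "j = Suc n" "i \<le> n" using ij by (cases j) auto
      have "h i \<le> h n" using mono n(2) by (simp add: strict_mono_less_eq)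
      then have "J (h i) \<le> (\<Sum>i\<le>h n. J i)" by (intro member_le_sum) auto
      then have "J (h i) \<le> h j" by (simp add: n h)
      then show ?thesis by (rule J)
    qed
    have hN: "N \<le> h k" for k using mono strict_mono_less_eq[of h 0 k] by (simp add: h)
    \<comment> \<open>\<open>v\<close> is rewritten as \<open>b j + b (w v)\<close> with
      \<open>w v < h k < j\<close>, so adding \<open>b (h k)\<close> on either side creates an
      ascent.\<close>
    have "v + b (h k) = \<sigma> 1" "b (h k) + v = \<sigma> 1" if v: "v \<in> V" for v k
    proof -
      obtain j where j: "h k < j" "b j + b (w v) = v"
        using w[OF v] unfolding infinite_nat_iff_unbounded by blast
      have "w v < h k" using N[OF v] hN[of k] by simp
      then have "b j + (b (w v) + b (h k)) = \<sigma> 1" by (simp add: asc left)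
      then show "v + b (h k) = \<sigma> 1" using j by (simp add: add.assoc[symmetric])
      have "(b (h k) + b j) + b (w v) = \<sigma> 1" by (simp add: asc[OF j(1)] right)
      then show "b (h k) + v = \<sigma> 1" using j by (simp add: add.assoc)
    qed
    moreover have "finite {b (h j) + b (h i) | i j. i < j}"
      by (rule finite_subset[OF _ 3(1)]) (use hV in auto)
    ultimately show ?thesis using mono hV by blast
  qed
qed

text \<open>Idempotence of \<open>\<sigma> m\<close> makes \<open>\<sigma>\<close> eventually
  periodic, so \<open>range \<sigma>\<close> is finite; together with the descending sums of a
  subsequence it forms the ideal for \<open>finite_ideal_types\<close>.\<close>

lemma types:
  assumes idem: "\<sigma> m + \<sigma> m = \<sigma> m"
  shows "has_type_a TYPE('a) \<or> has_type_b TYPE('a) \<or> has_type_c TYPE('a)"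
proof -
  have period: "\<sigma> (Suc (m + Suc m) + k) = \<sigma> (m + k)" for k
  proof (induction k)
    case 0
    show ?case using idem sigma_add[of m m] by (simp add: numeral_2_eq_2)
  next
    case (Suc k)
    then show ?case using right[of "Suc (m + Suc m) + k" 0] right[of "m + k" 0] by simp
  qed
  have "\<sigma> n \<in> \<sigma> ` {..< Suc (m + Suc m)}" for n
  proof (induction n rule: less_induct)
    case (less n)
    show ?case
    proof (cases "n < Suc (m + Suc m)")
      case False
      then obtain k where k: "n = Suc (m + Suc m) + k" using le_Suc_ex not_le_imp_less by blast
      then have "m + k < n" by simp
      then show ?thesis using less[of "m + k"] period[of k] k by simp
    qed simp
  qed
  then have "range \<sigma> \<subseteq> \<sigma> ` {..< Suc (m + Suc m)}" by blast
  then have fin: "finite (range \<sigma>)" by (rule finite_subset) simp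
  show ?thesis
  proof (cases "has_type_a TYPE('a)")
    case False
    then obtain h :: "nat \<Rightarrow> nat" where h: "strict_mono h"
      "finite {b (h j) + b (h i) | i j. i < j}"
      "\<And>i j k. i < j \<Longrightarrow> b (h j) + b (h i) + b (h k) = \<sigma> 1"
      "\<And>i j k. i < j \<Longrightarrow> b (h k) + (b (h j) + b (h i)) = \<sigma> 1"
      using descending_cases[OF fin] by blast
    define c where "c = b \<circ> h"
    interpret c: ascending_sums c \<sigma> unfolding c_def by (rule subsequence[OF h(1)])
    define V where "V = {c j + c i | i j. i < j}"
    have V: "finite V" "\<And>v k. v \<in> V \<Longrightarrow> v + c k = \<sigma> 1" "\<And>v k. v \<in> V \<Longrightarrow> c k + v = \<sigma> 1"
      using h by (auto simp: V_def c_def)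
    have Vs: "v + \<sigma> k = \<sigma> (k + 2)" "\<sigma> k + v = \<sigma> (k + 2)" if "v \<in> V" for v k
      using that c.desc_sigma by (auto simp: V_def)
    have VV: "v + v' = \<sigma> 2" if v: "v \<in> V" "v' \<in> V" for v v'
    proof -
      obtain i j where "v' = c j + c i" using v(2) by (auto simp: V_def)
      then have "v + v' = (v + c j) + c i" by (simp add: add.assoc)
      then show ?thesis using V(2)[OF v(1)] c.right by (simp add: numeral_2_eq_2)
    qed
    have desc: "c j + c i \<in> V" if "i < j" for i j using that by (auto simp: V_def)
    \<comment> \<open>The innermost \<open>c j + c i\<close> is a descending sum in
      \<open>V\<close>; adding further terms turns it into values of
      \<open>\<sigma>\<close>.\<close>
    have desc_mult: "mult_Suc (c j) (Suc m) + mult_Suc (c i) (Suc m) = \<sigma> m" if "i < j" for i j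
    proof -
      have V_mult: "v + mult_Suc (c i) n = \<sigma> (Suc n)" if "v \<in> V" for v n
        using V(2)[OF that] by (cases n) (simp_all add: add.assoc[symmetric] c.mult_right)
      have "mult_Suc (c j) (Suc m) + mult_Suc (c i) (Suc m)
          = mult_Suc (c j) m + ((c j + c i) + mult_Suc (c i) m)"
        by (simp only: mult_Suc_right[symmetric, of "c j"] mult_Suc.simps(2)[of "c i"] add.assoc)
      also have "\<dots> = \<sigma> (Suc (m + Suc m) + 0)"
        by (simp only: V_mult[OF desc[OF that]] c.mult_left add_0_right)
      finally show ?thesis using period[of 0] by simp
    qed
    \<comment> \<open>\<open>r = Suc m\<close> means \<open>m + 2\<close> copies, the number of
      terms in \<open>\<sigma> m\<close> and a period of \<open>\<sigma>\<close> from index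
      \<open>m\<close> on.\<close>
    show ?thesis
    proof (rule finite_ideal_types[where B = "range c" and \<Phi> = "range \<sigma> \<union> V" and r = "Suc m" and e = "\<sigma> m"])
      show "infinite (range c)" using c.inj finite_imageD by blast
      show "finite (range \<sigma> \<union> V)" using fin V by simp
      show "x + y \<in> range \<sigma> \<union> V" if "x \<in> range c" "y \<in> range c" "x \<noteq> y" for x y
      proof -
        obtain i j where ij: "x = c i" "y = c j" using \<open>x \<in> range c\<close> \<open>y \<in> range c\<close> by blast
        then have "i < j \<or> j < i" using \<open>x \<noteq> y\<close> by (metis linorder_neqE_nat)
        then show ?thesis using desc[of j i] c.asc[of i j] ij by auto
      qed
      show "x + y \<in> range \<sigma> \<union> V" if "x \<in> range c" "y \<in> range \<sigma> \<union> V" for x y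
        using that c.left V(3) by auto
      show "x + y \<in> range \<sigma> \<union> V" if "x \<in> range \<sigma> \<union> V" "y \<in> range c" for x y
        using that c.right V(2) by auto
      show "x + y \<in> range \<sigma> \<union> V" if "x \<in> range \<sigma> \<union> V" "y \<in> range \<sigma> \<union> V" for x y
        using that sigma_add Vs VV by auto
      show "mult_Suc x (Suc m) + mult_Suc y (Suc m) = \<sigma> m"
        if "x \<in> range c" "y \<in> range c" "x \<noteq> y" for x y
      proof -
        obtain i j where ij: "x = c i" "y = c j" using \<open>x \<in> range c\<close> \<open>y \<in> range c\<close> by blast
        then consider "i < j" | "j < i" using \<open>x \<noteq> y\<close> by (metis linorder_neqE_nat)
        then show ?thesis
        proof cases
          case 1
          then show ?thesis using c.mult_asc[OF 1, of "Suc m" "Suc m"] period[of 0]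
            unfolding ij by (simp del: mult_Suc.simps)
        next
          case 2
          then show ?thesis unfolding ij by (rule desc_mult)
        qed
      qed
      show "\<sigma> m + mult_Suc x (Suc m) = \<sigma> m" if "x \<in> range c" for x
        using that c.mult_right[of m _ "Suc m"] period[of 0] by (auto simp del: mult_Suc.simps simp: add.commute)
      show "mult_Suc x (Suc m) + \<sigma> m = \<sigma> m" if "x \<in> range c" for x
        using that c.mult_left[of _ "Suc m" m] period[of 0] by (auto simp del: mult_Suc.simps simp: add.commute)
    qed
  qed simp
qed

end

section \<open>From a principal square to one of the types\<close>

text \<open>As \<open>{s}\<close> lies in \<open>p + p\<close>, the set \<open>?X\<close> lies in
  \<open>p\<close>. Each new term is taken from \<open>?X\<close> and from the finitely many sets in
  \<open>p\<close> demanded by earlier terms; nonprincipality lets it avoid earlier values.\<close>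

lemma principal_square_sequence:
  fixes p :: "'a::semigroup_add uf"
  assumes p: "p \<notin> range princ" "p + p = princ s"
  obtains b :: "nat \<Rightarrow> 'a" where "inj b" "\<And>i j. i < j \<Longrightarrow> b i + b j = s"
proof -
  let ?X = "{x. {y. x + y = s} \<in> members p}"
  have X: "?X \<in> members p"
  proof -
    have "{s} \<in> members (p + p)" using p by simp
    then show ?thesis by (simp add: members_plus)
  qed
  have "\<exists>b :: nat \<Rightarrow> 'a. \<forall>n. b n \<in> ?X \<and> b n \<notin> b ` {..<n} \<and> (\<forall>i<n. b i + b n = s)"
  proof (rule dependent_wellorder_choice[where
        P = "\<lambda>b n r. r \<in> ?X \<and> r \<notin> b ` {..<n} \<and> (\<forall>i<n. b i + r = s)"])
    fix n :: nat and b :: "nat \<Rightarrow> 'a"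
    assume IH: "\<And>i. i < n \<Longrightarrow> b i \<in> ?X \<and> b i \<notin> b ` {..<i} \<and> (\<forall>j<i. b j + b i = s)"
    have "(\<Inter>i\<in>{..<n}. {y. b i + y = s}) \<in> members p"
      using IH by (intro members_finite_INT) auto
    then have "?X \<inter> (\<Inter>i\<in>{..<n}. {y. b i + y = s}) - b ` {..<n} \<in> members p"
      using X by (intro nonprinc_diff p) (simp_all add: members_Int)
    then obtain r where "r \<in> ?X \<inter> (\<Inter>i\<in>{..<n}. {y. b i + y = s}) - b ` {..<n}"
      using members_nonempty by blast
    then show "\<exists>r. r \<in> ?X \<and> r \<notin> b ` {..<n} \<and> (\<forall>i<n. b i + r = s)" by blast
  next
    fix r :: 'a and f g :: "nat \<Rightarrow> 'a" and n :: nat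
    assume "\<And>i. i < n \<Longrightarrow> f i = g i"
    then have "f ` {..<n} = g ` {..<n}" "(\<forall>i<n. f i + r = s) \<longleftrightarrow> (\<forall>i<n. g i + r = s)" by auto
    then show "(r \<in> ?X \<and> r \<notin> f ` {..<n} \<and> (\<forall>i<n. f i + r = s)) =
      (r \<in> ?X \<and> r \<notin> g ` {..<n} \<and> (\<forall>i<n. g i + r = s))" by simp
  qed
  then obtain b :: "nat \<Rightarrow> 'a" where b: "\<And>n. b n \<notin> b ` {..<n}" "\<And>i n. i < n \<Longrightarrow> b i + b n = s"
    by metis
  have "inj b"
  proof (rule linorder_injI)
    fix i j :: nat assume "i < j"
    then have "b i \<in> b ` {..<j}" by simp
    then show "b i \<noteq> b j" using b(1)[of j] by metis
  qed
  then show thesis by (rule that) (rule b(2))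
qed

lemma constant_ascending_types:
  fixes b :: "nat \<Rightarrow> 'a::semigroup_add"
  assumes inj: "inj b" and asc: "\<And>i j. i < j \<Longrightarrow> b i + b j = s"
    and idem: "mult_Suc s n + mult_Suc s n = mult_Suc s n"
  shows "has_type_a TYPE('a) \<or> has_type_b TYPE('a) \<or> has_type_c TYPE('a)"
proof -
  \<comment> \<open>Evaluates \<open>b i + b (Suc i) + b k\<close> in two ways.\<close>
  have shift: "b i + s = s + b k" if "Suc i < k" for i k
    using asc[of i "Suc i"] asc[of "Suc i" k] that by (metis add.assoc lessI)
  have s_right: "s + b (Suc (Suc k)) = s + b 2" for k
    using shift[of 0 "Suc (Suc k)"] shift[of 0 2] by simp
  have s_left: "b i + s = s + b 2" for i
    using shift[of i "Suc (Suc i)"] s_right[of i] by simp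
  \<comment> \<open>\<open>s + b k\<close> is known to be constant only from \<open>k = 2\<close>
    on, so two terms are dropped.\<close>
  define c where "c i = b (Suc (Suc i))" for i
  define \<sigma> where "\<sigma> = rec_nat s (\<lambda>_ x. x + c 0)"
  have \<sigma>: "\<sigma> 0 = s" "\<sigma> (Suc k) = \<sigma> k + c 0" for k by (simp_all add: \<sigma>_def)
  have left: "c i + \<sigma> k = \<sigma> (Suc k)" for i k
  proof (induction k)
    case 0
    then show ?case using s_left s_right[of 0] by (simp add: \<sigma> c_def)
  next
    case (Suc k)
    have "c i + \<sigma> (Suc k) = (c i + \<sigma> k) + c 0" by (simp add: \<sigma>(2) add.assoc)
    then show ?case by (simp add: Suc \<sigma>(2))
  qed
  have right: "\<sigma> k + c i = \<sigma> (Suc k)" for i k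
  proof (induction k)
    case 0
    then show ?case using s_right[of i] s_right[of 0] by (simp add: \<sigma> c_def)
  next
    case (Suc k)
    have "\<sigma> (Suc k) + c i = c 0 + (\<sigma> k + c i)" by (simp add: left[of 0 k, symmetric] add.assoc)
    then show ?case using Suc left by simp
  qed
  interpret ascending_sums c \<sigma>
  proof
    show "inj c" using inj by (auto simp: c_def inj_def)
    show "c i + c j = \<sigma> 0" if "i < j" for i j using asc that by (simp add: c_def \<sigma>)
  qed (rule left right)+
  \<comment> \<open>\<open>n + 1\<close> copies of \<open>s\<close> amount to
    \<open>2 * n + 2\<close> terms.\<close>
  have "mult_Suc s n = \<sigma> (2 * n)" for n
    by (induction n) (use sigma_add[of 0] in \<open>simp_all add: \<sigma>(1)\<close>)
  then show ?thesis using types[of "2 * n"] idem by simp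
qed

section \<open>Finite sums\<close>

lemma idxsum_singleton [simp]: "idxsum a {i} = a i"
  by (simp add: idxsum_def)

lemma sum1_append: "xs \<noteq> [] \<Longrightarrow> ys \<noteq> [] \<Longrightarrow> sum1 (xs @ ys) = sum1 xs + sum1 ys"
proof (induction xs rule: sum1.induct)
  case (2 x)
  then show ?case by (cases ys) auto
qed (auto simp: add.assoc)

lemma idxsum_Un:
  assumes "finite F" "F \<noteq> {}" "finite G" "G \<noteq> {}" "set_less F G"
  shows "idxsum a (F \<union> G) = idxsum a F + idxsum a G"
proof -
  have "F \<inter> G = {}" using assms(5) by (auto simp: set_less_def)
  then have "sorted_list_of_set (F \<union> G) = sorted_list_of_set F @ sorted_list_of_set G"
    using assms by (intro sorted_list_of_set_unique[THEN iffD1])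
      (auto simp: set_less_def sorted_wrt_append strict_sorted_iff card_Un_disjoint)
  then show ?thesis
    using assms by (simp add: idxsum_def sum1_append)
qed

lemma idxsum_insert_Min:
  assumes "finite F" "F \<noteq> {}" "\<And>j. j \<in> F \<Longrightarrow> i < j"
  shows "idxsum a (insert i F) = a i + idxsum a F"
  using idxsum_Un[of "{i}" F a] assms by (simp add: set_less_def)

lemma idxsum_pair: "i < j \<Longrightarrow> idxsum a {i, j} = a i + a j"
  using idxsum_insert_Min[of "{j}" i a] by simp

lemma idxsum_insert_Max:
  assumes "finite F" "F \<noteq> {}" "\<And>j. j \<in> F \<Longrightarrow> j < i"
  shows "idxsum a (insert i F) = idxsum a F + a i"
  using idxsum_Un[of F "{i}" a] assms by (simp add: set_less_def)

text \<open>The empty sum is \<open>undefined\<close>, so induction has to start at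
  singletons.\<close>

lemma index_set_induct [consumes 2, case_names singleton insert_Min]:
  fixes F :: "nat set"
  assumes "finite F" "F \<noteq> {}" and "\<And>i. P {i}"
    and "\<And>i F. finite F \<Longrightarrow> F \<noteq> {} \<Longrightarrow> (\<And>j. j \<in> F \<Longrightarrow> i < j) \<Longrightarrow> P F \<Longrightarrow> P (insert i F)"
  shows "P F"
proof -
  have "F \<noteq> {} \<longrightarrow> P F"
    using assms(1)
  proof (induction F rule: finite_linorder_min_induct)
    case (insert i F)
    then show ?case using assms(3,4) by (cases "F = {}") auto
  qed simp
  then show ?thesis using assms(2) by blast
qed

lemma index_set_induct_Max [consumes 2, case_names singleton insert_Max]:
  fixes F :: "nat set"
  assumes "finite F" "F \<noteq> {}" and "\<And>i. P {i}"
    and "\<And>i F. finite F \<Longrightarrow> F \<noteq> {} \<Longrightarrow> (\<And>j. j \<in> F \<Longrightarrow> j < i) \<Longrightarrow> P F \<Longrightarrow> P (insert i F)"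
  shows "P F"
proof -
  have "F \<noteq> {} \<longrightarrow> P F"
    using assms(1)
  proof (induction F rule: finite_linorder_max_induct)
    case (insert i F)
    then show ?case using assms(3,4) by (cases "F = {}") auto
  qed simp
  then show ?thesis using assms(2) by blast
qed

lemma FS_I: "finite F \<Longrightarrow> F \<noteq> {} \<Longrightarrow> idxsum a F \<in> FS a"
  by (auto simp: FS_def)

text \<open>The blocks selected by \<open>F\<close> are increasing, so their sums concatenate to the
  sum over their union.\<close>

lemma sumsequence_FS:
  assumes "sumsequence b a" shows "FS b \<subseteq> FS a"
proof -
  obtain Fs where Fs: "\<And>i. finite (Fs i) \<and> Fs i \<noteq> {}"
    "\<And>i j. i < j \<Longrightarrow> set_less (Fs i) (Fs j)" "\<And>i. b i = idxsum a (Fs i)"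
    using assms unfolding sumsequence_def by blast
  have "idxsum b F = idxsum a (\<Union>i\<in>F. Fs i)" if "finite F" "F \<noteq> {}" for F
    using that
  proof (induction F rule: index_set_induct)
    case (singleton i)
    then show ?case by (simp add: Fs)
  next
    case (insert_Min i F)
    have "set_less (Fs i) (\<Union>j\<in>F. Fs j)"
      using Fs(2) insert_Min(3) unfolding set_less_def by blast
    then have "idxsum a (Fs i \<union> (\<Union>j\<in>F. Fs j)) = idxsum a (Fs i) + idxsum a (\<Union>j\<in>F. Fs j)"
      using Fs(1) insert_Min(1,2) by (intro idxsum_Un) auto
    then show ?case using insert_Min by (simp add: idxsum_insert_Min Fs(3))
  qed
  then have "idxsum b F \<in> FS a" if "finite F" "F \<noteq> {}" for F
    using that Fs(1) by (simp add: FS_I)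
  then show ?thesis by (auto simp: FS_def[of b])
qed

lemma proper_seq_inj:
  assumes "proper_seq b" shows "inj b"
proof (rule linorder_injI)
  fix i j :: nat assume "i < j"
  then show "b i \<noteq> b j"
    using assms[unfolded proper_seq_def, rule_format, of "{i}" "{j}"] by (simp add: set_less_def)
qed

section \<open>Ultrafilters concentrated on finite sums\<close>

definition tail_FS :: "(nat \<Rightarrow> 'a::semigroup_add) \<Rightarrow> nat \<Rightarrow> 'a set" where
  "tail_FS a n = {idxsum a F | F. finite F \<and> F \<noteq> {} \<and> F \<subseteq> {n..}}"

text \<open>A sum over \<open>F\<close> may be followed by any sum over indices beyond
  \<open>Max F\<close>, and such sums form a set in \<open>q\<close>.\<close>

lemma closed_subsemigroup_tail_FS:
  "closed_subsemigroup {p. \<forall>n. tail_FS a n \<in> members p}"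
proof (rule closed_subsemigroupI)
  have "{p. \<forall>n. tail_FS a n \<in> members p} = (\<Inter>n. {p. tail_FS a n \<in> members p})" by blast
  then show "uf_closed {p. \<forall>n. tail_FS a n \<in> members p}"
    using uf_closed_INT[of "range (\<lambda>n. {p. tail_FS a n \<in> members p})"] uf_closed_members by auto
  fix p q assume pq: "p \<in> {p. \<forall>n. tail_FS a n \<in> members p}" "q \<in> {p. \<forall>n. tail_FS a n \<in> members p}"
  have "tail_FS a n \<in> members (p + q)" for n
  proof (rule members_plusI)
    show "tail_FS a n \<in> members p" using pq by blast
    fix x assume "x \<in> tail_FS a n"
    then obtain F where F: "x = idxsum a F" "finite F" "F \<noteq> {}" "F \<subseteq> {n..}"
      by (auto simp: tail_FS_def)
    have "tail_FS a (Suc (Max F)) \<subseteq> {y. x + y \<in> tail_FS a n}"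
    proof
      fix y assume "y \<in> tail_FS a (Suc (Max F))"
      then obtain G where G: "y = idxsum a G" "finite G" "G \<noteq> {}" "G \<subseteq> {Suc (Max F)..}"
        by (auto simp: tail_FS_def)
      then have less: "i < j" if "i \<in> F" "j \<in> G" for i j
        using Max_ge[OF F(2) that(1)] that(2) by force
      then have "x + y = idxsum a (F \<union> G)"
        using F G by (simp add: idxsum_Un set_less_def)
      moreover have "G \<subseteq> {n..}" using F(3,4) less by fastforce
      ultimately show "y \<in> {y. x + y \<in> tail_FS a n}"
        using F G by (auto simp: tail_FS_def intro!: exI[of _ "F \<union> G"])
    qed
    then show "{y. x + y \<in> tail_FS a n} \<in> members q"
      using pq(2) by (auto intro: members_mono)
  qed
  then show "p + q \<in> {p. \<forall>n. tail_FS a n \<in> members p}" by blast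
qed

text \<open>A nonprincipal ultrafilter on the range of \<open>a\<close> loses only finitely many
  terms in passing to a tail.\<close>

lemma tail_FS_nonprinc:
  assumes "inj a"
  shows "{p. \<forall>n. tail_FS a n \<in> members p} \<inter> - range princ \<noteq> {}"
proof -
  have "infinite (range a)" using assms finite_imageD by blast
  then obtain p where p: "p \<notin> range princ" "range a \<in> members p" using nonprinc_exists by blast
  have "tail_FS a n \<in> members p" for n
  proof (rule members_mono)
    show "range a - a ` {..<n} \<in> members p" using p by (intro nonprinc_diff) auto
    show "range a - a ` {..<n} \<subseteq> tail_FS a n"
    proof
      fix x assume "x \<in> range a - a ` {..<n}"
      then obtain i where "x = a i" "n \<le> i" by (auto simp: not_less[symmetric])
      then show "x \<in> tail_FS a n" unfolding tail_FS_def by (intro CollectI exI[of _ "{i}"]) simp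
    qed
  qed
  then show ?thesis using p(1) by blast
qed

text \<open>The Galvin--Glazer construction. The sets \<open>B n\<close> shrink so that every sum of
  \<open>b n, b (n+1), \<dots>\<close> lies in \<open>B n\<close>, while \<open>E n\<close> collects the sums of
  \<open>b 0, \<dots>, b (n-1)\<close>, which are removed from \<open>B n\<close>.\<close>
lemma proper_sumsequence_of_idempotent:
  fixes a :: "nat \<Rightarrow> 'a::semigroup_add"
  assumes q: "q \<notin> range princ" "q + q = q" and tail: "\<And>n. tail_FS a n \<in> members q"
    and A: "A \<in> members q"
  obtains b where "sumsequence b a" "proper_seq b" "FS b \<subseteq> A"
proof -
  \<comment> \<open>\<open>S B x\<close> is the translate \<open>-x + B\<close>;
    \<open>star B\<close> keeps the points of \<open>B\<close> after which almost every continuation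
    stays in \<open>B\<close>. Idempotence of \<open>q\<close> keeps \<open>star B\<close> in
    \<open>q\<close>.\<close>
  define S where "S B x = {y. x + y \<in> B}" for B and x :: 'a
  define star where "star B = {x \<in> B. S B x \<in> members q}" for B
  have star: "star B \<in> members q" if B: "B \<in> members q" for B
  proof -
    have "B \<in> members (q + q)" using B q(2) by simp
    then have "{x. S B x \<in> members q} \<in> members q" by (simp add: members_plus S_def)
    then have "B \<inter> {x. S B x \<in> members q} \<in> members q" using B by (simp add: members_Int)
    then show ?thesis by (simp add: star_def Int_def)
  qed
  define ok where "ok = (\<lambda>(F, B, E). finite F \<and> F \<noteq> {} \<and> B \<in> members q \<and> finite E \<and>
    B \<inter> E = {} \<and> idxsum a F \<in> star B)"
  define step where "step = (\<lambda>(F, B, E) (F', B', E'). set_less F F' \<and>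
    B' \<subseteq> B \<inter> S B (idxsum a F) \<and> E \<union> {idxsum a F} \<union> (\<lambda>x. x + idxsum a F) ` E \<subseteq> E')"
  have choose: "\<exists>F. finite F \<and> F \<noteq> {} \<and> F \<subseteq> {n..} \<and> idxsum a F \<in> star B" if B: "B \<in> members q" for B n
  proof -
    have "star B \<inter> tail_FS a n \<in> members q" using star[OF B] tail by (simp add: members_Int)
    then obtain x where "x \<in> star B \<inter> tail_FS a n" using members_nonempty by blast
    then show ?thesis unfolding tail_FS_def by blast
  qed
  have "\<exists>f. \<forall>n. (ok (f n) \<and> (n = 0 \<longrightarrow> fst (snd (f n)) \<subseteq> A)) \<and> step (f n) (f (Suc n))"
  proof (rule dependent_nat_choice)
    obtain F where "finite F" "F \<noteq> {}" "idxsum a F \<in> star A" using choose[OF A] by blast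
    then have "ok (F, A, {})" using A by (simp add: ok_def)
    then show "\<exists>x. ok x \<and> (0 = (0::nat) \<longrightarrow> fst (snd x) \<subseteq> A)" by (intro exI[of _ "(F, A, {})"]) simp
  next
    fix t and n :: nat assume t: "ok t \<and> (n = 0 \<longrightarrow> fst (snd t) \<subseteq> A)"
    obtain F B E where [simp]: "t = (F, B, E)" by (cases t)
    have F: "finite F" "F \<noteq> {}" and B: "B \<in> members q" and E: "finite E" "B \<inter> E = {}"
      and x: "idxsum a F \<in> star B"
      using t by (auto simp: ok_def)
    define E' where "E' = E \<union> {idxsum a F} \<union> (\<lambda>x. x + idxsum a F) ` E"
    define B' where "B' = B \<inter> S B (idxsum a F) - E'"
    have E': "finite E'" using E by (simp add: E'_def)
    have B': "B' \<in> members q"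
      using x B E' q unfolding B'_def star_def by (intro nonprinc_diff) (auto simp: members_Int)
    obtain F' where F': "finite F'" "F' \<noteq> {}" "F' \<subseteq> {Suc (Max F)..}" "idxsum a F' \<in> star B'"
      using choose[OF B'] by blast
    have "set_less F F'"
      unfolding set_less_def
    proof (intro ballI)
      fix i j assume ij: "i \<in> F" "j \<in> F'"
      then show "i < j" using Max_ge[OF F(1) ij(1)] F'(3) by force
    qed
    then have "step t (F', B', E')"
      by (simp add: step_def E'_def B'_def) blast
    moreover have "ok (F', B', E')" using F' B' E' by (auto simp: ok_def B'_def)
    ultimately show "\<exists>y. (ok y \<and> (Suc n = 0 \<longrightarrow> fst (snd y) \<subseteq> A)) \<and> step t y" by blast
  qed
  then obtain f where f: "\<And>n. ok (f n)" "fst (snd (f 0)) \<subseteq> A" "\<And>n. step (f n) (f (Suc n))"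
    by blast
  define Fs where "Fs n = fst (f n)" for n
  define B where "B n = fst (snd (f n))" for n
  define E where "E n = snd (snd (f n))" for n
  define b where "b n = idxsum a (Fs n)" for n
  have f_eq: "f n = (Fs n, B n, E n)" for n by (simp add: Fs_def B_def E_def)
  have ok: "finite (Fs n)" "Fs n \<noteq> {}" "B n \<inter> E n = {}" "b n \<in> B n" for n
    using f(1)[of n] by (auto simp: f_eq ok_def b_def star_def)
  have step: "set_less (Fs n) (Fs (Suc n))" "B (Suc n) \<subseteq> B n" "B (Suc n) \<subseteq> S (B n) (b n)"
    "E n \<subseteq> E (Suc n)" "b n \<in> E (Suc n)" "(\<lambda>x. x + b n) ` E n \<subseteq> E (Suc n)" for n
    using f(3)[of n] by (auto simp: f_eq step_def b_def)
  have less: "set_less (Fs i) (Fs j)" if "i < j" for i j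
    using that
  proof (induction j)
    case (Suc j)
    show ?case
    proof (cases "i = j")
      case False
      then have "set_less (Fs i) (Fs j)" using Suc by simp
      moreover obtain k where "k \<in> Fs j" using ok by blast
      ultimately show ?thesis using step(1)[of j] unfolding set_less_def by (meson less_trans)
    qed (simp add: step)
  qed simp
  have B_mono: "B j \<subseteq> B i" if "i \<le> j" for i j by (rule lift_Suc_antimono_le[OF _ that]) (rule step)
  have E_mono: "E i \<subseteq> E j" if "i \<le> j" for i j by (rule lift_Suc_mono_le[OF _ that]) (rule step)
  have in_B: "idxsum b F \<in> B (Min F)" if "finite F" "F \<noteq> {}" for F
    using that
  proof (induction F rule: index_set_induct)
    case (singleton i)
    then show ?case by (simp add: ok)
  next
    case (insert_Min i F)
    then have "B (Min F) \<subseteq> B (Suc i)" by (intro B_mono) (simp add: Suc_le_eq)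
    then have "idxsum b F \<in> S (B i) (b i)" using insert_Min.IH step(3)[of i] by blast
    then have "idxsum b (insert i F) \<in> B i"
      using insert_Min by (simp add: idxsum_insert_Min S_def)
    moreover have "Min (insert i F) = i" using insert_Min by (intro Min_eqI) (auto intro: less_imp_le)
    ultimately show ?case by simp
  qed
  have in_E: "idxsum b F \<in> E (Suc (Max F))" if "finite F" "F \<noteq> {}" for F
    using that
  proof (induction F rule: index_set_induct_Max)
    case (singleton i)
    then show ?case by (simp add: step)
  next
    case (insert_Max i F)
    then have "E (Suc (Max F)) \<subseteq> E i" by (intro E_mono) (simp add: Suc_le_eq)
    then have "idxsum b F + b i \<in> E (Suc i)" using insert_Max.IH step(6)[of i] by blast
    then have "idxsum b (insert i F) \<in> E (Suc i)"
      using insert_Max by (simp add: idxsum_insert_Max)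
    moreover have "Max (insert i F) = i" using insert_Max by (intro Max_eqI) (auto intro: less_imp_le)
    ultimately show ?case by simp
  qed
  show thesis
  proof (rule that)
    show "sumsequence b a"
      unfolding sumsequence_def by (intro exI[of _ Fs]) (auto simp: ok less b_def)
    have "idxsum b F \<noteq> idxsum b G"
      if FG: "finite F" "F \<noteq> {}" "finite G" "G \<noteq> {}" "set_less F G" for F G
    proof -
      \<comment> \<open>So the sum over \<open>F\<close> is already recorded in
        \<open>E (Min G)\<close>, which is disjoint from the set \<open>B (Min G)\<close> containing
        the sum over \<open>G\<close>.\<close>
      have "Max F < Min G" using FG by (simp add: set_less_def)
      then have "idxsum b F \<in> E (Min G)"
        using in_E[OF FG(1,2)] E_mono[of "Suc (Max F)" "Min G"] by auto
      then show ?thesis using in_B[OF FG(3,4)] ok(3)[of "Min G"] by auto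
    qed
    then show "proper_seq b" by (simp add: proper_seq_def)
    have "idxsum b F \<in> A" if "finite F" "F \<noteq> {}" for F
      using in_B[OF that] B_mono[of 0 "Min F"] f(2) by (auto simp: B_def)
    then show "FS b \<subseteq> A" by (auto simp: FS_def)
  qed
qed

section \<open>Implications from the excluded types to the other conditions\<close>

lemma cond3_imp_cond5:
  assumes "cond3 TYPE('a::semigroup_add)" shows "cond5 TYPE('a)"
  unfolding cond5_def
proof (intro allI impI)
  fix a :: "nat \<Rightarrow> 'a" and c :: "'a \<Rightarrow> nat"
  assume ac: "inj a \<and> finite_coloring c"
  let ?T = "{p. \<forall>n. tail_FS a n \<in> members p}"
  have "\<exists>q\<in>?T. q + q = q \<and> q \<notin> range princ"
  proof (rule ccontr)
    assume "\<not> ?thesis"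
    then obtain p :: "'a uf" and s n where p: "p \<notin> range princ" "p + p = princ s"
      and idem: "mult_Suc s n + mult_Suc s n = mult_Suc s n"
      using principal_square[OF closed_subsemigroup_tail_FS tail_FS_nonprinc] ac by metis
    obtain b :: "nat \<Rightarrow> 'a" where "inj b" "\<And>i j. i < j \<Longrightarrow> b i + b j = s"
      using principal_square_sequence[OF p] by blast
    then have "has_type_a TYPE('a) \<or> has_type_b TYPE('a) \<or> has_type_c TYPE('a)"
      using idem by (rule constant_ascending_types)
    then show False using assms by (simp add: cond3_def)
  qed
  then obtain q where q: "q \<notin> range princ" "q + q = q" "\<And>n. tail_FS a n \<in> members q" by blast
  have "(\<Union>k\<in>range c. c -` {k}) = UNIV" by auto
  then obtain k where k: "c -` {k} \<in> members q"
    using members_finite_UN[of "range c" "\<lambda>k. c -` {k}" q] ac by (auto simp: finite_coloring_def)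
  obtain b where "sumsequence b a" "proper_seq b" "FS b \<subseteq> c -` {k}"
    using proper_sumsequence_of_idempotent[OF q k] by blast
  then show "\<exists>b k. sumsequence b a \<and> proper_seq b \<and> (\<forall>x\<in>FS b. c x = k)" by blast
qed

lemma cond5_imp_cond4: "cond5 T \<Longrightarrow> cond4 T"
  unfolding cond5_def cond4_def using proper_seq_inj by metis

lemma cond5_imp_cond2:
  assumes "cond5 T" shows "cond2 T"
proof -
  have "finite_coloring (\<lambda>_. 0)" by (auto simp: finite_coloring_def intro: finite_subset[of _ "{0}"])
  then show ?thesis using assms unfolding cond5_def cond2_def by meson
qed

lemma cond4_imp_cond1:
  assumes "cond4 TYPE('a::semigroup_add)" shows "cond1 TYPE('a)"
  unfolding cond1_def
proof (intro allI impI)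
  fix A :: "'a set" and c :: "'a \<Rightarrow> nat"
  assume Ac: "proper_IP A \<and> finite (c ` A)"
  then obtain a where a: "inj a" "FS a \<subseteq> A" by (auto simp: proper_IP_def)
  \<comment> \<open>\<open>c\<close> is known to take finitely many values only on \<open>A\<close>,
    so it is made constant outside.\<close>
  define c' where "c' x = (if x \<in> A then c x else 0)" for x
  have "range c' \<subseteq> insert 0 (c ` A)" by (auto simp: c'_def)
  then have "finite_coloring c'" using Ac unfolding finite_coloring_def by (auto intro: finite_subset)
  then obtain b k where b: "sumsequence b a" "inj b" "\<forall>x\<in>FS b. c' x = k"
    using assms a(1) unfolding cond4_def by blast
  have "FS b \<subseteq> A" using sumsequence_FS[OF b(1)] a(2) by blast
  have "c x = k" if "x \<in> FS b" for x
    using b(3) that \<open>FS b \<subseteq> A\<close> unfolding c'_def by (metis subsetD)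
  then have "FS b \<subseteq> {x \<in> A. c x = k}" using \<open>FS b \<subseteq> A\<close> by blast
  then show "\<exists>k. proper_IP {x \<in> A. c x = k}" using b(2) unfolding proper_IP_def by blast
qed

section \<open>The three types as obstructions\<close>

text \<open>Extracts one common obstacle: \<open>F\<close> is the set of all sums for type (a), and
  consists of the zero alone for (b) and (c).\<close>

lemma not_cond3_obstruction:
  assumes "\<not> cond3 TYPE('a::semigroup_add)"
  obtains a :: "nat \<Rightarrow> 'a::semigroup_add" and F where "inj a" "finite F" "\<And>k l. k \<noteq> l \<Longrightarrow> a k + a l \<in> F"
    "\<And>k x. x \<in> F \<Longrightarrow> a k + x \<in> F"
proof -
  consider "has_type_a TYPE('a)" | "has_type_b TYPE('a)" | "has_type_c TYPE('a)"
    using assms by (auto simp: cond3_def)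
  then show thesis
  proof cases
    case 1
    then obtain T :: "'a set" where T: "\<And>x y. x \<in> T \<Longrightarrow> y \<in> T \<Longrightarrow> x + y \<in> T" "infinite T"
      "finite {x + y | x y. x \<in> T \<and> y \<in> T}"
      unfolding has_type_a_def by blast
    obtain a :: "nat \<Rightarrow> 'a" where a: "inj a" "range a \<subseteq> T"
      using infinite_countable_subset[OF T(2)] by blast
    show thesis
      by (rule that[OF a(1) T(3)]) (use a(2) T(1) in blast)+
  next
    case 2
    then obtain f :: "nat \<Rightarrow> 'a" where f: "inj_on f {1..}"
      "\<And>m n. m \<ge> 1 \<Longrightarrow> n \<ge> 1 \<Longrightarrow> m \<noteq> n \<Longrightarrow> f m + f n = f 1"
      unfolding has_type_b_def by blast
    show thesis
    \<comment> \<open>The shift by 2 skips index 0 and the zero \<open>f 1\<close> of the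
      fan.\<close>
    proof (rule that[of "\<lambda>n. f (n + 2)" "{f 1}"])
      show "inj (\<lambda>n. f (n + 2))" using f(1) by (auto simp: inj_on_def)
    qed (use f(2) in auto)
  next
    case 3
    then show thesis
      unfolding has_type_c_def
    proof (elim exE conjE)
      fix z :: 'a and g :: "nat \<times> nat \<Rightarrow> 'a"
      assume g: "inj_on g {p. fst p \<ge> 1 \<and> snd p \<ge> 1}"
        "\<forall>m\<ge>1. \<forall>n\<ge>1. z + g (m, n) = z \<and> g (m, n) + z = z"
        "\<forall>m1\<ge>1. \<forall>m2\<ge>1. \<forall>n1\<ge>1. \<forall>n2\<ge>1. m1 \<noteq> m2 \<longrightarrow> g (m1, n1) + g (m2, n2) = z"
      show thesis
      proof (rule that[of "\<lambda>n. g (Suc n, 1)" "{z}"])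
        show "inj (\<lambda>n. g (Suc n, 1))"
          by (rule injI, drule inj_onD[OF g(1)]) auto
      qed (use g(2,3) in auto)
    qed
  qed
qed

lemma idxsum_obstruction:
  assumes "\<And>k l. k \<noteq> l \<Longrightarrow> a k + a l \<in> F" "\<And>k x. x \<in> F \<Longrightarrow> a k + x \<in> F"
    and "finite I" "I \<noteq> {}"
  shows "(\<exists>i. I = {i}) \<or> idxsum a I \<in> F"
  using assms(3,4)
proof (induction I rule: index_set_induct)
  case (insert_Min i I)
  have "idxsum a (insert i I) = a i + idxsum a I"
    using insert_Min(1-3) by (intro idxsum_insert_Min)
  then show ?case using insert_Min assms(1,2) by (metis idxsum_singleton insertI1 less_irrefl)
qed simp

text \<open>Sums of consecutive disjoint pairs of a proper sumsequence are distinct, yet all lie in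
  the finite set \<open>F\<close>.\<close>

lemma cond2_imp_cond3:
  assumes "cond2 TYPE('a::semigroup_add)" shows "cond3 TYPE('a)"
proof (rule ccontr)
  assume "\<not> cond3 TYPE('a)"
  then obtain a :: "nat \<Rightarrow> 'a" and F where a: "inj a" "finite F" "\<And>k l. k \<noteq> l \<Longrightarrow> a k + a l \<in> F"
    "\<And>k x. x \<in> F \<Longrightarrow> a k + x \<in> F"
    using not_cond3_obstruction by blast
  then obtain b where b: "sumsequence b a" "proper_seq b" using assms by (auto simp: cond2_def)
  obtain Fs where Fs: "\<And>i. finite (Fs i) \<and> Fs i \<noteq> {}"
    "\<And>i j. i < j \<Longrightarrow> set_less (Fs i) (Fs j)" "\<And>i. b i = idxsum a (Fs i)"
    using b(1) unfolding sumsequence_def by blast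
  have in_F: "b i + b j \<in> F" if "i < j" for i j
  proof -
    have less: "set_less (Fs i) (Fs j)" using Fs(2) that by blast
    have "b i + b j = idxsum a (Fs i \<union> Fs j)"
      using Fs less by (simp add: idxsum_Un)
    moreover have "\<not> (\<exists>k. Fs i \<union> Fs j = {k})"
    proof
      assume "\<exists>k. Fs i \<union> Fs j = {k}"
      then obtain k where "Fs i \<union> Fs j = {k}" by blast
      then have "Fs i \<subseteq> {k}" "Fs j \<subseteq> {k}" by blast+
      then have "k \<in> Fs i" "k \<in> Fs j" using Fs(1)[of i] Fs(1)[of j] by auto
      then show False using less by (auto simp: set_less_def)
    qed
    ultimately show ?thesis
      using idxsum_obstruction[where a = a and I = "Fs i \<union> Fs j", OF a(3,4)] Fs(1) by auto
  qed
  define d where "d i = b (2 * i) + b (Suc (2 * i))" for i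
  have d: "d i = idxsum b {2 * i, Suc (2 * i)}" for i
    by (simp add: d_def idxsum_pair)
  have "inj d"
  proof (rule linorder_injI)
    fix i j :: nat assume "i < j"
    then show "d i \<noteq> d j"
      unfolding d using b(2)[unfolded proper_seq_def, rule_format, of "{2 * i, Suc (2 * i)}" "{2 * j, Suc (2 * j)}"]
      by (simp add: set_less_def)
  qed
  moreover have "range d \<subseteq> F" using in_F by (auto simp: d_def)
  ultimately show False using a(2) by (metis finite_imageD finite_subset infinite_UNIV_nat)
qed

text \<open>Points of \<open>F\<close> get separate nonzero colors, all others color 0. A
  monochromatic injective \<open>b\<close> then avoids \<open>F\<close>, so its terms are terms of
  \<open>a\<close>; but \<open>b 0 + b 1\<close> lies in \<open>F\<close>.\<close>

lemma cond1_imp_cond3: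
  assumes "cond1 TYPE('a::semigroup_add)" shows "cond3 TYPE('a)"
proof (rule ccontr)
  assume "\<not> cond3 TYPE('a)"
  then obtain a :: "nat \<Rightarrow> 'a" and F where a: "inj a" "finite F" "\<And>k l. k \<noteq> l \<Longrightarrow> a k + a l \<in> F"
    "\<And>k x. x \<in> F \<Longrightarrow> a k + x \<in> F"
    using not_cond3_obstruction by blast
  obtain h :: "'a \<Rightarrow> nat" where h: "inj_on h F"
    using finite_imp_inj_to_nat_seg[OF a(2)] by blast
  define c where "c x = (if x \<in> F then Suc (h x) else 0)" for x
  have "c ` FS a \<subseteq> insert 0 (Suc ` h ` F)" by (auto simp: c_def)
  then have "finite (c ` FS a)" by (rule finite_subset) (use a(2) in simp)
  moreover have "proper_IP (FS a)" using a(1) by (auto simp: proper_IP_def)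
  ultimately obtain k where "proper_IP {x \<in> FS a. c x = k}" using assms unfolding cond1_def by blast
  then obtain b where b: "inj b" "FS b \<subseteq> {x \<in> FS a. c x = k}" by (auto simp: proper_IP_def)
  have b_in: "b i \<in> FS a \<and> c (b i) = k" for i using b(2) FS_I[of "{i}" b] by auto
  have b_notin: "b i \<notin> F" for i
  proof
    assume "b i \<in> F"
    then have "c (b i) \<noteq> 0" by (simp add: c_def)
    moreover have eq: "c (b (Suc i)) = c (b i)" using b_in by simp
    ultimately have "b (Suc i) \<in> F" by (simp add: c_def split: if_splits)
    then have "b (Suc i) = b i" using eq h \<open>b i \<in> F\<close> by (auto simp: c_def dest: inj_onD)
    then show False using b(1) by (auto dest: injD)
  qed
  have "\<exists>m. b i = a m" for i
  proof -
    obtain I where "finite I" "I \<noteq> {}" "b i = idxsum a I" using b_in[of i] by (auto simp: FS_def)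
    then show ?thesis using idxsum_obstruction[where a = a and I = I, OF a(3,4)] b_notin[of i] by auto
  qed
  then obtain m where m: "\<And>i. b i = a (m i)" by metis
  have "m 0 \<noteq> m 1" using m b(1) by (metis injD zero_neq_one)
  then have "b 0 + b 1 \<in> F" using a(3) by (simp add: m)
  moreover have "c (b 0 + b 1) = k"
    using b(2) FS_I[of "{0, 1}" b] by (auto simp: idxsum_pair)
  ultimately have "c (b 0) \<noteq> 0" using b_in[of 0] by (auto simp: c_def)
  then show False using b_notin[of 0] by (simp add: c_def)
qed

theorem theorem3p4:
  fixes S :: "'a::semigroup_add itself"
  shows "(cond1 S \<longleftrightarrow> cond2 S) \<and> (cond2 S \<longleftrightarrow> cond3 S) \<and>
         (cond3 S \<longleftrightarrow> cond4 S) \<and> (cond4 S \<longleftrightarrow> cond5 S)"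
proof -
  have "cond1 S = cond1 TYPE('a)" "cond2 S = cond2 TYPE('a)" "cond3 S = cond3 TYPE('a)"
    "cond4 S = cond4 TYPE('a)" "cond5 S = cond5 TYPE('a)"
    by (simp_all only: cond1_def cond2_def cond3_def cond4_def cond5_def
        has_type_a_def has_type_b_def has_type_c_def)
  then show ?thesis
    using cond3_imp_cond5 cond5_imp_cond4 cond5_imp_cond2 cond4_imp_cond1 cond2_imp_cond3 cond1_imp_cond3
    by metis
qed

end
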